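(* Let $d$ be a positive integer and let $\mu_1, \ldots, \mu_{d+1}$ be $d+1$ finite measures on $\mathbb{R}^d$, each absolutely continuous with respect to the Lebesgue measure. Then there exist two parallel hyperplanes $H_1, H_2$ in $\mathbb{R}^d$ such that the closed region between them contains exactly half of each measure, i.e. if $A$ denotes this region then $\mu_i(A) = \frac{1}{2}\mu_i(\mathbb{R}^d)$ for all $i = 1, \ldots, d+1$.
   Context: Convention used by the paper: if some single hyperplane $H_1$ halves all the measures, then $H_2$ may be taken "at infinity", in which case the region between $H_1$ and $H_2$ is a closed half-space bounded by $H_1$. *)

theory Defs
  imports "HOL-Analysis.Analysis"
begin

text \<open>\<open>A\<close> is the closed region between the distinct parallel hyperplanes \<open>H1\<close> and \<open>H2\<close>.
  Replacing \<open>v\<close> by \<open>- v\<close> shows that \<open>a < b\<close> is only a choice of orientation, not of the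
  order of \<open>H1\<close> and \<open>H2\<close>.\<close>

definition closed_region_between ::
    "'a::euclidean_space set \<Rightarrow> 'a set \<Rightarrow> 'a set \<Rightarrow> bool" where
  "closed_region_between H1 H2 A \<longleftrightarrow>
     (\<exists>v a b. v \<noteq> 0 \<and> a < b \<and>
        H1 = {x. v \<bullet> x = a} \<and> H2 = {x. v \<bullet> x = b} \<and>
        A = {x. a \<le> v \<bullet> x \<and> v \<bullet> x \<le> b})"

text \<open>The region between \<open>H1\<close> and a parallel hyperplane at infinity; both sides of \<open>H1\<close>
  are covered, since \<open>v\<close> may be replaced by \<open>- v\<close>.\<close>

definition closed_halfspace_bounded_by :: "'a::euclidean_space set \<Rightarrow> 'a set \<Rightarrow> bool" where
  "closed_halfspace_bounded_by H1 A \<longleftrightarrow>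
     (\<exists>v a. v \<noteq> 0 \<and> H1 = {x. v \<bullet> x = a} \<and> A = {x. a \<le> v \<bullet> x})"

end

(*
Idea of the proof. Fix a direction y and one of the measures, nu, and assume for the moment that nu
charges every open set. The slabs orthogonal to y of nu-measure 1/2 then form a one-parameter
family, from the half-space below the nu-median (t = 0) to the half-space above it (t = 1/2);
replacing y by -y exchanges t and 1/2 - t. Let G(y, t) in R^d record the excess over one half of the
other d measures. It is odd in y for t = 0, where the slabs of y and -y are complementary, and even
in y for t = 1/4, where they coincide. Reading t off the sup-norm of y makes G a map on the annulus
1 <= |y| <= 2 that is odd outside and even inside. A nowhere vanishing G would be a homotopy
between an odd and an even self-map of the sphere, which is excluded by parity of the degree. The
general case follows by adding a small multiple of a fully supported measure to nu and passing to
the limit, with slabs whose bounds are extended reals.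

The parity argument is combinatorial, in the style of Ky Fan's proof of the Borsuk-Ulam theorem:
simplices of the Kuhn triangulation of the grid with alternating labels are counted modulo 2.
*)
theory Submission
  imports Defs
begin

text \<open>How parity excludes a zero-free map: grid points get one of 2 * d labels (coordinate and
  sign), and a simplex whose d + 1 sorted labels alternate in sign contains a complementary pair. If
  close points never carry complementary labels, no simplex of the annulus alternates, so the inner
  and the outer cube contain equally many alternating simplices, whatever the labels inside the
  inner cube are. Yet this number is odd for a cube whose boundary labels are antipodal and free of
  complementary edges, and even for symmetric boundary labels. Sup-norm and Kuhn triangulation fit
  together here: each face of the cube inherits the triangulation, and v -> -v preserves it.

  Full support of nu serves continuity: otherwise its quantiles in direction y need be neither
  unique nor continuous in y. The passage to the limit leaves one danger, a slab that degenerates to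
  the whole space or into a hyperplane; such a slab cannot halve a nonzero measure.\<close>

section \<open>Alternating lists of labels\<close>

lemma even_card_involution:
  assumes "finite A" "\<And>a. a \<in> A \<Longrightarrow> f a \<in> A" "\<And>a. a \<in> A \<Longrightarrow> f (f a) = a" "\<And>a. a \<in> A \<Longrightarrow> f a \<noteq> a"
  shows "even (card A)"
proof -
  let ?C = "(\<lambda>a. {a, f a}) ` A"
  have "2 * card ?C = card (\<Union>?C)"
  proof (rule card_partition)
    show "finite ?C" using assms by auto
    have "\<Union>?C \<subseteq> A" using assms by auto
    then show "finite (\<Union>?C)" using assms(1) finite_subset by blast
    show "card c = 2" if "c \<in> ?C" for c
      using that assms(4) by (force simp: card_2_iff)
    show "c1 \<inter> c2 = {}" if "c1 \<in> ?C" "c2 \<in> ?C" "c1 \<noteq> c2" for c1 c2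
    proof -
      from that(1,2) obtain a b where "a \<in> A" "b \<in> A" and ab: "c1 = {a, f a}" "c2 = {b, f b}"
        by (elim imageE)
      then have "f (f a) = a" "f (f b) = b" using assms(3) by auto
      show ?thesis
      proof (rule ccontr)
        assume "c1 \<inter> c2 \<noteq> {}"
        then have "a = b \<or> a = f b \<or> f a = b \<or> f a = f b" unfolding ab by blast
        then have "a = b \<or> a = f b" using \<open>f (f a) = a\<close> \<open>f (f b) = b\<close> by metis
        then show False using that(3) \<open>f (f b) = b\<close> unfolding ab by auto
      qed
    qed
  qed
  moreover have "\<Union>?C = A" using assms by auto
  ultimately show ?thesis by (metis dvd_triv_left)
qed

definition del :: "nat \<Rightarrow> 'a list \<Rightarrow> 'a list" where
  "del k xs = take k xs @ drop (Suc k) xs"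

lemma del_0 [simp]: "del 0 (x # xs) = xs"
  by (simp add: del_def)

lemma del_Suc [simp]: "del (Suc k) (x # xs) = x # del k xs"
  by (simp add: del_def)

lemma map_del: "map f (del k xs) = del k (map f xs)"
  by (simp add: del_def take_map drop_map)

lemma mset_del: "k < length xs \<Longrightarrow> mset (del k xs) = mset xs - {#xs ! k#}"
proof (induction xs arbitrary: k)
  case (Cons x xs)
  then show ?case by (cases k) (auto simp: nth_Cons')
qed simp

lemma sorted_del:
  assumes "sorted (xs :: 'a::linorder list)"
  shows "sorted (del k xs)"
proof (cases "k < length xs")
  case True
  have "sorted (take k xs @ xs ! k # drop (Suc k) xs)"
    using assms True by (metis id_take_nth_drop)
  then show ?thesis by (auto simp: del_def sorted_append)
next
  case False
  then show ?thesis using assms by (simp add: del_def)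
qed

fun alternating :: "bool \<Rightarrow> bool list \<Rightarrow> bool" where
  "alternating c [] = True"
| "alternating c (b # bs) = (b = c \<and> alternating (\<not> c) bs)"

lemma alternating_exclusive: "bs \<noteq> [] \<Longrightarrow> alternating c bs \<Longrightarrow> \<not> alternating (\<not> c) bs"
  by (cases bs) auto

lemma alternating_map_Not: "alternating c (map Not bs) = alternating (\<not> c) bs"
  by (induction bs arbitrary: c) auto

lemma Collect_less_Suc: "{k. k < Suc n \<and> P k} = {k. k = 0 \<and> P 0} \<union> Suc ` {k. k < n \<and> P (Suc k)}"
  using less_Suc_eq_0_disj by auto

text \<open>The parity fact behind both counts below, of facets of simplices and of faces of the
  cube. An alternating word has exactly one such deletion: its last entry if it starts with
  \<open>c\<close>, its first otherwise. Any other word has none, or the two entries of its only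
  repeated pair.\<close>

lemma odd_card_del_alternating:
  assumes "bs \<noteq> []"
  shows "odd (card {k. k < length bs \<and> alternating c (del k bs)}) \<longleftrightarrow>
         alternating c bs \<or> alternating (\<not> c) bs"
  using assms
proof (induction bs arbitrary: c)
  case (Cons b bs)
  have "{k. k < length (b # bs) \<and> alternating c (del k (b # bs))} =
     {k. k = 0 \<and> alternating c bs} \<union> Suc ` {k. k < length bs \<and> b = c \<and> alternating (\<not> c) (del k bs)}"
    unfolding length_Cons Collect_less_Suc by simp
  moreover have "card \<dots> = card {k::nat. k = 0 \<and> alternating c bs}
      + card (Suc ` {k. k < length bs \<and> b = c \<and> alternating (\<not> c) (del k bs)})"
    by (rule card_Un_disjoint) auto
  moreover have "card {k::nat. k = 0 \<and> alternating c bs} = of_bool (alternating c bs)"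
    by (auto simp: card_1_singleton_iff)
  ultimately have *: "card {k. k < length (b # bs) \<and> alternating c (del k (b # bs))} =
     of_bool (alternating c bs) + card {k. k < length bs \<and> b = c \<and> alternating (\<not> c) (del k bs)}"
    by (simp add: card_image)
  show ?case
  proof (cases "bs = []")
    case True
    then show ?thesis unfolding * by auto
  next
    case False
    note IH = Cons.IH[OF this, of "\<not> c"] and ex = alternating_exclusive[OF False, of c]
    show ?thesis
    proof (cases "b = c")
      case True
      then show ?thesis using IH ex unfolding * by auto
    next
      case False
      then show ?thesis unfolding * by auto
    qed
  qed
qed simp

text \<open>Fan's alternating simplices: ordered by coordinate, the labels change sign at each step.
  Sorting makes this a property of the set of vertices, independent of their order along a
  path.\<close>

definition alt_labels :: "bool \<Rightarrow> nat list \<Rightarrow> bool" where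
  "alt_labels c xs = alternating c (map even (sort xs))"

lemma alt_labels_mset_cong: "mset xs = mset ys \<Longrightarrow> alt_labels c xs = alt_labels c ys"
  unfolding alt_labels_def by (metis sorted_list_of_multiset_mset)

lemma alt_labels_exclusive: "xs \<noteq> [] \<Longrightarrow> alt_labels c xs \<Longrightarrow> \<not> alt_labels (\<not> c) xs"
  unfolding alt_labels_def by (rule alternating_exclusive) (auto dest: arg_cong[of _ _ length])

text \<open>Removing values from a multiset instead of positions from a list shows that the count is
  the same for \<open>xs\<close> and \<open>sort xs\<close>.\<close>

lemma card_alt_labels_del:
  "card {k. k < length xs \<and> alt_labels c (del k xs)} =
   length (filter (\<lambda>x. alt_labels c (sorted_list_of_multiset (mset xs - {#x#}))) xs)"
proof -
  have "alt_labels c (del k xs) = alt_labels c (sorted_list_of_multiset (mset xs - {#xs ! k#}))"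
    if "k < length xs" for k
    by (rule alt_labels_mset_cong) (simp add: mset_del that)
  then show ?thesis unfolding length_filter_conv_card by (metis (no_types, lifting))
qed

lemma odd_card_del_alt_labels:
  assumes "xs \<noteq> []"
  shows "odd (card {k. k < length xs \<and> alt_labels c (del k xs)}) \<longleftrightarrow>
         alt_labels c xs \<or> alt_labels (\<not> c) xs"
proof -
  let ?s = "sort xs"
  have "card {k. k < length xs \<and> alt_labels c (del k xs)} =
        card {k. k < length ?s \<and> alt_labels c (del k ?s)}"
  proof -
    have "length (filter P xs) = length (filter P ?s)" for P
      by (metis mset_filter mset_sort size_mset)
    then show ?thesis unfolding card_alt_labels_del by simp
  qed
  moreover have "alt_labels c (del k ?s) = alternating c (del k (map even ?s))" for k
    unfolding alt_labels_def map_del[symmetric] by (subst sorted_sort_id[OF sorted_del[OF sorted_sort]]) (rule refl)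
  moreover have "map even ?s \<noteq> []"
    using assms by (metis Nil_is_map_conv length_0_conv length_sort)
  note odd_card_del_alternating[OF this, of c]
  ultimately show ?thesis unfolding alt_labels_def by (simp only: length_map)
qed

section \<open>Complementary labels and reversal of signs\<close>

text \<open>The labels \<open>2 * i\<close> and \<open>2 * i + 1\<close> stand for the two signs of the coordinate \<open>i\<close>.\<close>
definition flip :: "nat \<Rightarrow> nat" where
  "flip n = (if even n then n + 1 else n - 1)"

lemma even_flip [simp]: "even (flip n) = odd n"
  by (auto simp: flip_def)

lemma flip_mono: "m \<le> n \<Longrightarrow> m \<noteq> flip n \<Longrightarrow> flip m \<le> flip n"
  by (auto simp: flip_def elim!: evenE oddE)

text \<open>Labels of different coordinates keep their order under \<open>flip\<close>; only a
  complementary pair would be interchanged. Without such pairs \<open>flip\<close> commutes with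
  sorting and merely reverses all parities.\<close>

lemma alt_labels_map_flip:
  assumes "\<And>m n. m \<in> set xs \<Longrightarrow> n \<in> set xs \<Longrightarrow> m \<noteq> flip n"
  shows "alt_labels c (map flip xs) = alt_labels (\<not> c) xs"
proof -
  have "sort (map flip xs) = map flip (sort xs)"
  proof (rule properties_for_sort)
    have "sorted_wrt (\<lambda>m n. flip m \<le> flip n) (sort xs)"
      by (rule sorted_wrt_mono_rel[OF _ sorted_sort]) (use assms in \<open>auto intro: flip_mono\<close>)
    then show "sorted (map flip (sort xs))" by (simp add: sorted_wrt_map)
  qed simp
  then have "map even (sort (map flip xs)) = map Not (map even (sort xs))" by simp
  then show ?thesis unfolding alt_labels_def by (metis alternating_map_Not)
qed

text \<open>An alternating list without complementary entries is strictly increasing even after dividing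
  by two, so there are too few labels below \<open>2 * d\<close>.\<close>
lemma alternating_pigeonhole:
  assumes "alternating c (map even xs)" "sorted xs" "\<And>m n. m \<in> set xs \<Longrightarrow> n \<in> set xs \<Longrightarrow> m \<noteq> flip n"
    and "\<And>m. m \<in> set xs \<Longrightarrow> m < 2 * d"
  shows "length xs \<le> d"
proof -
  have "sorted_wrt (<) (map (\<lambda>n. n div 2) xs)"
    using assms(1-3)
  proof (induction xs arbitrary: c)
    case (Cons x xs)
    show ?case
    proof (cases xs)
      case (Cons y ys)
      have IH: "sorted_wrt (<) (map (\<lambda>n. n div 2) xs)"
        using Cons.IH[of "\<not> c"] Cons.prems by auto
      have "x \<le> y" "even x \<noteq> even y" "x \<noteq> flip y" "y \<noteq> flip x"
        using Cons.prems Cons by auto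
      then have "x div 2 < y div 2"
        by (auto simp: flip_def elim!: evenE oddE)
      then show ?thesis using IH Cons by auto
    qed simp
  qed simp
  then have d: "distinct (map (\<lambda>n. n div 2) xs)" by (simp add: strict_sorted_iff)
  have "set (map (\<lambda>n. n div 2) xs) \<subseteq> {..<d}" using assms(4) by force
  then show ?thesis
    using card_mono[of "{..<d}" "set (map (\<lambda>n. n div 2) xs)"] distinct_card[OF d] by simp
qed

section \<open>Kuhn simplices and pivoting\<close>

text \<open>A pair \<open>(x, is)\<close> encodes the simplex whose vertices arise from \<open>x\<close> by adding the unit
  vectors of \<open>is\<close> one after the other.\<close>
fun kuhn_path :: "(nat \<Rightarrow> int) \<Rightarrow> nat list \<Rightarrow> (nat \<Rightarrow> int) list" where
  "kuhn_path x [] = [x]"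
| "kuhn_path x (i # is) = x # kuhn_path (x(i := x i + 1)) is"

lemma length_kuhn_path [simp]: "length (kuhn_path x is) = Suc (length is)"
  by (induction "is" arbitrary: x) auto

lemma kuhn_path_nonempty [simp]: "kuhn_path x is \<noteq> []"
  by (cases "is") auto

lemma kuhn_path_snoc: "distinct (is @ [i]) \<Longrightarrow>
   kuhn_path x (is @ [i]) = kuhn_path x is @ [\<lambda>j. x j + of_bool (j \<in> insert i (set is))]"
  by (induction "is" arbitrary: x) (auto simp: fun_eq_iff)

lemma kuhn_path_bounds:
  "v \<in> set (kuhn_path x is) \<Longrightarrow> distinct is \<Longrightarrow> x j \<le> v j \<and> v j \<le> x j + of_bool (j \<in> set is)"
  by (induction "is" arbitrary: x) (force split: if_splits)+

text \<open>The reflected simplex starts at the negative of the last vertex and takes the same unit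
  steps in reverse order. Hence the triangulation is symmetric under negation.\<close>

lemma kuhn_path_antipode:
  "distinct is \<Longrightarrow> kuhn_path (\<lambda>j. - x j - of_bool (j \<in> set is)) (rev is) = rev (map (\<lambda>v j. - v j) (kuhn_path x is))"
proof (induction "is" arbitrary: x)
  case (Cons i "is")
  define y where "y = (\<lambda>j. - x j - of_bool (j \<in> set (i # is)) :: int)"
  have "y = (\<lambda>j. - (x(i := x i + 1)) j - of_bool (j \<in> set is))"
    using Cons.prems by (auto simp: fun_eq_iff y_def)
  then have "kuhn_path y (rev is) = rev (map (\<lambda>v j. - v j) (kuhn_path (x(i := x i + 1)) is))"
    using Cons.IH[of "x(i := x i + 1)"] Cons.prems by (simp del: fun_upd_apply)
  moreover have "kuhn_path y (rev is @ [i]) = kuhn_path y (rev is) @ [\<lambda>j. - x j]"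
    using Cons.prems by (subst kuhn_path_snoc) (auto simp: fun_eq_iff y_def)
  ultimately have "kuhn_path y (rev (i # is)) = rev (map (\<lambda>v j. - v j) (kuhn_path x (i # is)))"
    by (simp del: fun_upd_apply)
  then show ?case unfolding y_def .
qed simp

lemma del_last_kuhn_path: "distinct (is @ [i]) \<Longrightarrow> del (Suc (length is)) (kuhn_path x (is @ [i])) = kuhn_path x is"
  by (simp add: kuhn_path_snoc del_def)

text \<open>Exchanging two consecutive steps changes only the vertex between them, so the two
  simplices share the facet opposite to it.\<close>

lemma del_kuhn_path_swap:
  "i \<noteq> j \<Longrightarrow> del (Suc (length is)) (kuhn_path x (is @ i # j # js)) = del (Suc (length is)) (kuhn_path x (is @ j # i # js))"
  by (induction "is" arbitrary: x) (auto simp: fun_upd_twist)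

text \<open>The full-dimensional simplices of the face of [-N, N]^d with free coordinates
  \<open>D\<close> and the others fixed by \<open>z\<close>. As \<open>x\<close> is the least corner
  and each free coordinate grows by one, its upper bound is strict.\<close>

definition cells :: "int \<Rightarrow> nat set \<Rightarrow> (nat \<Rightarrow> int) \<Rightarrow> ((nat \<Rightarrow> int) \<times> nat list) set" where
  "cells N D z = {(x, is). distinct is \<and> set is = D \<and> (\<forall>i\<in>D. - N \<le> x i \<and> x i < N) \<and> (\<forall>i. i \<notin> D \<longrightarrow> x i = z i)}"

lemma finite_cells: "finite D \<Longrightarrow> finite (cells N D z)"
proof -
  assume D: "finite D"
  have "cells N D z \<subseteq> (\<lambda>f i. if i \<in> D then f i else z i) ` (\<Pi>\<^sub>E i\<in>D. {-N..<N}) \<times> {is. set is \<subseteq> D \<and> distinct is}"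
  proof
    fix p assume "p \<in> cells N D z"
    then obtain x "is" where p: "p = (x, is)" "distinct is" "set is = D" "\<forall>i\<in>D. - N \<le> x i \<and> x i < N" "\<forall>i. i \<notin> D \<longrightarrow> x i = z i"
      unfolding cells_def by auto
    have "x = (\<lambda>i. if i \<in> D then restrict x D i else z i)" using p by auto
    moreover have "restrict x D \<in> (\<Pi>\<^sub>E i\<in>D. {-N..<N})" using p by auto
    ultimately show "p \<in> (\<lambda>f i. if i \<in> D then f i else z i) ` (\<Pi>\<^sub>E i\<in>D. {-N..<N}) \<times> {is. set is \<subseteq> D \<and> distinct is}"
      using p by blast
  qed
  then show ?thesis
    by (rule finite_subset) (use D in \<open>auto intro!: finite_PiE finite_subset_distinct\<close>)
qed


text \<open>Passes from a simplex to its neighbour across the facet opposite to the vertex \<open>k\<close>.\<close>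
definition pivot :: "(nat \<Rightarrow> int) \<times> nat list \<times> nat \<Rightarrow> (nat \<Rightarrow> int) \<times> nat list \<times> nat" where
  "pivot = (\<lambda>(x, is, k).
     if k = 0 then (x(hd is := x (hd is) + 1), tl is @ [hd is], length is)
     else if k = length is then (x(last is := x (last is) - 1), last is # butlast is, 0)
     else (x, take (k - 1) is @ is ! k # is ! (k - 1) # drop (Suc k) is, k))"

lemma pivot_first: "pivot (x, i # is, 0) = (x(i := x i + 1), is @ [i], Suc (length is))"
  by (simp add: pivot_def)

lemma pivot_last: "pivot (x, is @ [i], Suc (length is)) = (x(i := x i - 1), i # is, 0)"
  by (simp add: pivot_def)

lemma pivot_middle:
  "pivot (x, is @ i # j # js, Suc (length is)) = (x, is @ j # i # js, Suc (length is))"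
  by (simp add: pivot_def nth_append)

text \<open>Pairs of a simplex and one of its facets are matched by \<open>pivot\<close>, which
  keeps the facet and changes the simplex. Unmatched are the pairs whose neighbour would leave the
  cube, and their facets are precisely the simplices of the faces in which one free coordinate is
  set to \<open>N\<close> or \<open>- N\<close>.\<close>

lemma even_card_facets:
  fixes P :: "(nat \<Rightarrow> int) list \<Rightarrow> bool"
  assumes D: "finite D" "D \<noteq> {}" and N: "N > 0"
  shows "even (card {(x, is, k). (x, is) \<in> cells N D z \<and> k \<le> length is \<and> P (del k (kuhn_path x is))} +
     (\<Sum>i\<in>D. \<Sum>c\<in>{-N, N}. card {(x, is). (x, is) \<in> cells N (D - {i}) (z(i := c)) \<and> P (kuhn_path x is)}))"
    (is "even (card ?T + _)")
proof -
  define A where "A = (\<lambda>i c. {(x, is). (x, is) \<in> cells N (D - {i}) (z(i := c)) \<and> P (kuhn_path x is)})"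
  have finA: "finite (A i c)" for i c
    by (rule finite_subset[OF _ finite_cells[of "D - {i}" N "z(i := c)"]]) (use D in \<open>auto simp: A_def\<close>)
  \<comment> \<open>The facet opposite to the first vertex lies where the first step has been made,
    so it is on the boundary if this step reaches \<open>N\<close>. Dually, for \<open>B1\<close>,
    the facet opposite to the last vertex lies before the last step and is on the boundary if that
    coordinate is still \<open>- N\<close>.\<close>
  define B0 where "B0 = {(x, is, k). (x, is, k) \<in> ?T \<and> k = 0 \<and> x (hd is) + 1 = N}"
  define B1 where "B1 = {(x, is, k). (x, is, k) \<in> ?T \<and> k = length is \<and> x (last is) = - N}"
  have finT: "finite ?T"
  proof (rule finite_subset)
    show "?T \<subseteq> (\<lambda>((x, is), k). (x, is, k)) ` (cells N D z \<times> {..card D})"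
    proof clarsimp
      fix x "is" k assume "(x, is) \<in> cells N D z" "k \<le> length is"
      then have "k \<le> card D" by (auto simp: cells_def distinct_card)
      then show "(x, is, k) \<in> (\<lambda>((x, is), k). (x, is, k)) ` (cells N D z \<times> {..card D})"
        using \<open>(x, is) \<in> cells N D z\<close> by force
    qed
    show "finite ((\<lambda>((x, is), k). (x, is, k)) ` (cells N D z \<times> {..card D}))"
      using finite_cells[OF D(1)] by auto
  qed
  have nonempty: "is \<noteq> []" if "(x, is) \<in> cells N D z" for x "is"
    using that D by (auto simp: cells_def)
  have "B0 = (\<lambda>(i, x, is). (x(i := N - 1), i # is, 0)) ` (SIGMA i:D. A i N)" (is "_ = ?f ` ?S")
  proof (intro set_eqI iffI)
    fix p assume "p \<in> B0"
    then obtain x "is" where p: "p = (x, is, 0)" "(x, is) \<in> cells N D z" "P (del 0 (kuhn_path x is))" "x (hd is) + 1 = N"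
      unfolding B0_def by auto
    obtain i js where "is": "is = i # js" using nonempty[OF p(2)] by (cases "is") auto
    have "p = ?f (i, x(i := N), js)" using p "is" by (auto simp: fun_eq_iff)
    moreover have "(i, x(i := N), js) \<in> ?S"
      using p "is" by (auto simp: A_def cells_def)
    ultimately show "p \<in> ?f ` ?S" by blast
  next
    fix p assume "p \<in> ?f ` ?S"
    then obtain i x "is" where p: "p = (x(i := N - 1), i # is, 0)" "i \<in> D" "(x, is) \<in> A i N" by auto
    then have "x i = N" by (auto simp: A_def cells_def)
    then have "x(i := N) = x" by (auto simp: fun_eq_iff)
    then show "p \<in> B0" using p N by (auto simp: B0_def A_def cells_def)
  qed
  moreover have "inj_on (\<lambda>(i, x, is). (x(i := N - 1), i # is, 0::nat)) (SIGMA i:D. A i N)"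
    by (rule inj_onI) (auto simp: A_def cells_def fun_eq_iff split: if_splits, metis)
  ultimately have card0: "card B0 = (\<Sum>i\<in>D. card (A i N))"
    using D finA by (simp add: card_image card_SigmaI)
  have "B1 = (\<lambda>(i, x, is). (x, is @ [i], Suc (length is))) ` (SIGMA i:D. A i (- N))" (is "_ = ?g ` ?S'")
  proof (intro set_eqI iffI)
    fix p assume "p \<in> B1"
    then obtain x "is" where p: "p = (x, is, length is)" "(x, is) \<in> cells N D z"
        "P (del (length is) (kuhn_path x is))" "x (last is) = - N"
      unfolding B1_def by auto
    obtain i js where "is": "is = js @ [i]" using nonempty[OF p(2)] by (cases "is" rule: rev_cases) auto
    have "distinct (js @ [i])" using p "is" by (auto simp: cells_def)
    then have "P (kuhn_path x js)" using p(3) del_last_kuhn_path "is" by simp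
    then have "(i, x, js) \<in> ?S'"
      using p "is" by (auto simp: A_def cells_def)
    moreover have "p = ?g (i, x, js)" using p "is" by auto
    ultimately show "p \<in> ?g ` ?S'" by blast
  next
    fix p assume "p \<in> ?g ` ?S'"
    then obtain i x "is" where p: "p = (x, is @ [i], Suc (length is))" "i \<in> D" "(x, is) \<in> A i (- N)" by auto
    then have d: "distinct (is @ [i])" by (auto simp: A_def cells_def)
    show "p \<in> B1" using p N del_last_kuhn_path[OF d, of x] by (auto simp: B1_def A_def cells_def)
  qed
  moreover have "inj_on (\<lambda>(i, x, is). (x, is @ [i], Suc (length is))) (SIGMA i:D. A i (- N))"
    by (rule inj_onI) auto
  ultimately have card1: "card B1 = (\<Sum>i\<in>D. card (A i (- N)))"
    using D finA by (simp add: card_image card_SigmaI)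
  have "even (card (?T - (B0 \<union> B1)))"
  proof (rule even_card_involution[where f = pivot])
    show "finite (?T - (B0 \<union> B1))" using finT by blast
    fix p assume p: "p \<in> ?T - (B0 \<union> B1)"
    then obtain x "is" k where p_eq: "p = (x, is, k)" and xs: "(x, is) \<in> cells N D z" and k: "k \<le> length is"
      and P: "P (del k (kuhn_path x is))" by auto
    have d: "distinct is" using xs by (auto simp: cells_def)
    consider (first) i js where "k = 0" "is = i # js" | (last) i js where "k = Suc (length js)" "is = js @ [i]"
      | (middle) i j js js' where "k = Suc (length js)" "is = js @ i # j # js'"
    proof (cases "k = 0")
      case True
      then show ?thesis using nonempty[OF xs] that(1) by (cases "is") auto
    next
      case False
      then obtain l where l: "k = Suc l" by (cases k) auto
      define js where "js = take l is"
      have js: "length js = l" "is = js @ is ! l # drop (Suc l) is"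
        using k l by (auto simp: js_def id_take_nth_drop[symmetric])
      show ?thesis
      proof (cases "drop (Suc l) is")
        case Nil
        then show ?thesis using that(2)[of js "is ! l"] js l by simp
      next
        case (Cons j js')
        then show ?thesis using that(3)[of js "is ! l" j js'] js l by simp
      qed
    qed
    then have res: "pivot p \<in> ?T - (B0 \<union> B1) \<and> pivot (pivot p) = p \<and> pivot p \<noteq> p"
    proof cases
      case first
      have pp: "pivot p = (x(i := x i + 1), js @ [i], Suc (length js))"
        unfolding p_eq first by (rule pivot_first)
      have "x i + 1 \<noteq> N" using p p_eq first by (auto simp: B0_def)
      moreover have "distinct (js @ [i])" using d first by auto
      moreover have "P (kuhn_path (x(i := x i + 1)) js)" using P first by simp
      ultimately have "pivot p \<in> ?T - (B0 \<union> B1)"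
        unfolding pp using xs first by (auto simp: cells_def B0_def B1_def del_last_kuhn_path)
      then show ?thesis using first unfolding pp pivot_last by (auto simp: p_eq)
    next
      case last
      have pp: "pivot p = (x(i := x i - 1), i # js, 0)"
        unfolding p_eq last by (rule pivot_last)
      have "x i \<noteq> - N" using p p_eq last by (auto simp: B1_def)
      moreover have "distinct (js @ [i])" using d last by auto
      moreover from this have "P (kuhn_path x js)" using P last by (simp only: del_last_kuhn_path)
      ultimately have "pivot p \<in> ?T - (B0 \<union> B1)"
        unfolding pp using xs last by (auto simp: cells_def B0_def B1_def)
      then show ?thesis using last unfolding pp pivot_first by (auto simp: p_eq)
    next
      case middle
      have pp: "pivot p = (x, js @ j # i # js', Suc (length js))"
        unfolding p_eq middle by (rule pivot_middle)
      have "i \<noteq> j" using d middle by auto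
      then have "P (del (Suc (length js)) (kuhn_path x (js @ j # i # js')))"
        using P middle del_kuhn_path_swap by metis
      then have "pivot p \<in> ?T - (B0 \<union> B1)"
        unfolding pp using xs middle by (auto simp: cells_def B0_def B1_def)
      then show ?thesis using \<open>i \<noteq> j\<close> middle unfolding pp pivot_middle by (auto simp: p_eq)
    qed
    show "pivot p \<in> ?T - (B0 \<union> B1)" by (rule res[THEN conjunct1])
    show "pivot (pivot p) = p" "pivot p \<noteq> p" using res by blast+
  qed
  moreover have "card ?T = card (?T - (B0 \<union> B1)) + (card B0 + card B1)"
  proof -
    have sub: "B0 \<union> B1 \<subseteq> ?T" by (auto simp: B0_def B1_def)
    then have fin: "finite B0" "finite B1" using finT by (meson finite_Un finite_subset)+
    have "B0 \<inter> B1 = {}" using nonempty by (auto simp: B0_def B1_def)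
    then have "card (B0 \<union> B1) = card B0 + card B1" using fin by (simp add: card_Un_disjoint)
    then show ?thesis
      using card_Diff_subset[of "B0 \<union> B1" ?T] card_mono[OF finT sub] sub fin by simp
  qed
  moreover have "(\<Sum>i\<in>D. \<Sum>c\<in>{-N, N}. card (A i c)) = card B0 + card B1"
    using N by (simp add: card0 card1 sum.distrib)
  ultimately show ?thesis unfolding A_def by simp
qed

section \<open>A Ky Fan count on the cube\<close>

text \<open>Facets with labels alternating from \<open>True\<close> are counted twice: a simplex has
  an odd number of them exactly if its own labels alternate in one of the two senses, and pivoting
  cancels all but those in the boundary.\<close>

lemma odd_card_alt_cells:
  fixes lab :: "(nat \<Rightarrow> int) \<Rightarrow> nat"
  assumes D: "finite D" "D \<noteq> {}" and N: "N > 0"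
  shows "even (card {(x, is). (x, is) \<in> cells N D z \<and>
        (alt_labels True (map lab (kuhn_path x is)) \<or> alt_labels False (map lab (kuhn_path x is)))} +
     (\<Sum>i\<in>D. \<Sum>c\<in>{-N, N}. card {(x, is). (x, is) \<in> cells N (D - {i}) (z(i := c)) \<and>
        alt_labels True (map lab (kuhn_path x is))}))"
    (is "even (card ?A + ?S)")
proof -
  define P where "P = (\<lambda>vs. alt_labels True (map lab vs))"
  define T where "T = {(x, is, k). (x, is) \<in> cells N D z \<and> k \<le> length is \<and> P (del k (kuhn_path x is))}"
  have T: "T = (\<lambda>(p, k). (fst p, snd p, k)) ` (SIGMA p:cells N D z. {k. k \<le> length (snd p) \<and> P (del k (kuhn_path (fst p) (snd p)))})"
    (is "_ = _ ` (Sigma _ ?K)")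
    unfolding T_def by force
  have "inj_on (\<lambda>(p, k). (fst p, snd p, k)) (Sigma (cells N D z) ?K)"
    by (rule inj_onI) (auto simp: prod_eq_iff)
  then have "card T = card (Sigma (cells N D z) ?K)" unfolding T by (rule card_image)
  also have "\<dots> = (\<Sum>p\<in>cells N D z. card (?K p))"
    using finite_cells[OF D(1)] by (intro card_SigmaI) auto
  finally have "even (card T) \<longleftrightarrow> even (card {p \<in> cells N D z. odd (card (?K p))})"
    using finite_cells[OF D(1)] by (simp add: even_sum_iff)
  also have "{p \<in> cells N D z. odd (card (?K p))} = ?A"
  proof -
    have "odd (card (?K (x, is))) \<longleftrightarrow>
        alt_labels True (map lab (kuhn_path x is)) \<or> alt_labels False (map lab (kuhn_path x is))" for x "is"
      using odd_card_del_alt_labels[of "map lab (kuhn_path x is)" True]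
      by (simp add: P_def map_del less_Suc_eq_le)
    then show ?thesis by auto
  qed
  finally have "even (card T) \<longleftrightarrow> even (card ?A)" .
  moreover have "even (card T + ?S)"
    using even_card_facets[OF D N, of z P] unfolding T_def P_def .
  ultimately show ?thesis by simp
qed

lemma card_cells_antipode:
  "card {(x, is). (x, is) \<in> cells N D (\<lambda>i. - z i) \<and> P (kuhn_path x is)} =
   card {(x, is). (x, is) \<in> cells N D z \<and> P (rev (map (\<lambda>v j. - v j) (kuhn_path x is)))}"
    (is "card ?A = card ?B")
proof -
  define g :: "(nat \<Rightarrow> int) \<times> nat list \<Rightarrow> _" where
    "g = (\<lambda>(x, is). (\<lambda>j. - x j - of_bool (j \<in> set is), rev is))"
  have gg: "g (g p) = p" for p by (cases p) (simp add: g_def fun_eq_iff)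
  have cells: "(x, is) \<in> cells N D (\<lambda>i. - z i) \<Longrightarrow> g (x, is) \<in> cells N D z" for x "is" z
    by (fastforce simp: g_def cells_def)
  have path: "kuhn_path (fst (g (x, is))) (snd (g (x, is))) = rev (map (\<lambda>v j. - v j) (kuhn_path x is))"
    if "(x, is) \<in> cells N D z" for x "is" z
    using that kuhn_path_antipode[of "is" x] by (simp add: g_def cells_def)
  have "bij_betw g ?A ?B"
  proof (rule bij_betw_byWitness[where f' = g])
    show "g ` ?A \<subseteq> ?B"
    proof clarify
      fix x "is" y js assume a: "(y, js) = g (x, is)" "(x, is) \<in> cells N D (\<lambda>i. - z i)" "P (kuhn_path x is)"
      have y: "(y, js) \<in> cells N D z" using cells a by metis
      have "kuhn_path x is = rev (map (\<lambda>v j. - v j) (kuhn_path y js))"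
        using path[OF y] a(1) gg[of "(x, is)"] by simp
      then show "(y, js) \<in> cells N D z \<and> P (rev (map (\<lambda>v j. - v j) (kuhn_path y js)))"
        using a y by simp
    qed
    show "g ` ?B \<subseteq> ?A"
    proof clarify
      fix x "is" y js assume a: "(y, js) = g (x, is)" "(x, is) \<in> cells N D z"
        "P (rev (map (\<lambda>v j. - v j) (kuhn_path x is)))"
      have "(y, js) \<in> cells N D (\<lambda>i. - z i)" using cells[of x "is" "\<lambda>i. - z i"] a by simp
      then show "(y, js) \<in> cells N D (\<lambda>i. - z i) \<and> P (kuhn_path y js)"
        using path[OF a(2)] a by (metis fst_conv snd_conv)
    qed
  qed (use gg in auto)
  then show ?thesis by (rule bij_betw_same_card)
qed

section \<open>Faces of the cube, their antipodes and their label counts\<close>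

text \<open>A sign pattern \<open>\<tau>\<close> stands for the face of the cube on which each coordinate \<open>i \<in> dom \<tau>\<close> is
  fixed to \<open>N\<close> or \<open>- N\<close>.\<close>
definition face_val :: "int \<Rightarrow> (nat \<rightharpoonup> bool) \<Rightarrow> nat \<Rightarrow> int" where
  "face_val N \<tau> i = (case \<tau> i of None \<Rightarrow> 0 | Some c \<Rightarrow> if c then N else - N)"

definition face_cells :: "nat \<Rightarrow> int \<Rightarrow> (nat \<rightharpoonup> bool) \<Rightarrow> ((nat \<Rightarrow> int) \<times> nat list) set" where
  "face_cells d N \<tau> = cells N ({..<d} - dom \<tau>) (face_val N \<tau>)"

definition face_count ::
  "nat \<Rightarrow> int \<Rightarrow> ((nat \<Rightarrow> int) \<Rightarrow> nat) \<Rightarrow> (nat list \<Rightarrow> bool) \<Rightarrow> (nat \<rightharpoonup> bool) \<Rightarrow> nat" where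
  "face_count d N lab Q \<tau> = card {(x, is). (x, is) \<in> face_cells d N \<tau> \<and> Q (map lab (kuhn_path x is))}"

abbreviation alt_either :: "nat list \<Rightarrow> bool" where
  "alt_either ls \<equiv> alt_labels True ls \<or> alt_labels False ls"

lemma face_count_step:
  assumes "{..<d} - dom \<tau> \<noteq> {}" and N: "N > 0"
  shows "even (face_count d N lab alt_either \<tau> +
     (\<Sum>i\<in>{..<d} - dom \<tau>. \<Sum>c\<in>UNIV. face_count d N lab (alt_labels True) (\<tau>(i \<mapsto> c))))"
proof -
  have 1: "cells N ({..<d} - dom \<tau> - {i}) ((face_val N \<tau>)(i := if c then N else - N)) = face_cells d N (\<tau>(i \<mapsto> c))" for i c
  proof -
    have "{..<d} - dom \<tau> - {i} = {..<d} - dom (\<tau>(i \<mapsto> c))" by auto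
    moreover have "(face_val N \<tau>)(i := if c then N else - N) = face_val N (\<tau>(i \<mapsto> c))"
      by (auto simp: face_val_def fun_eq_iff)
    ultimately show ?thesis by (simp only: face_cells_def)
  qed
  have "(\<Sum>c\<in>{-N, N}. card {(x, is). (x, is) \<in> cells N ({..<d} - dom \<tau> - {i}) ((face_val N \<tau>)(i := c)) \<and>
        alt_labels True (map lab (kuhn_path x is))}) =
      (\<Sum>c\<in>UNIV. face_count d N lab (alt_labels True) (\<tau>(i \<mapsto> c)))" for i
    using N 1[of i True] 1[of i False] by (simp add: face_count_def UNIV_bool add.commute)
  then show ?thesis
    using odd_card_alt_cells[of "{..<d} - dom \<tau>" N "face_val N \<tau>" lab] assms
    by (simp add: face_count_def[of _ _ _ alt_either] face_cells_def[of _ _ \<tau>])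
qed

definition antip :: "(nat \<rightharpoonup> bool) \<Rightarrow> (nat \<rightharpoonup> bool)" where
  "antip \<tau> = (\<lambda>i. map_option Not (\<tau> i))"

lemma dom_antip [simp]: "dom (antip \<tau>) = dom \<tau>"
  by (auto simp: antip_def dom_def)

lemma antip_antip [simp]: "antip (antip \<tau>) = \<tau>"
  by (auto simp: antip_def fun_eq_iff option.map_comp comp_def option.map_ident)

lemma face_count_antip:
  "face_count d N lab Q (antip \<tau>) =
   card {(x, is). (x, is) \<in> face_cells d N \<tau> \<and> Q (rev (map (\<lambda>v. lab (\<lambda>j. - v j)) (kuhn_path x is)))}"
proof -
  have "face_val N (antip \<tau>) = (\<lambda>i. - face_val N \<tau> i)"
    by (auto simp: face_val_def antip_def fun_eq_iff split: option.splits)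
  then show ?thesis
    using card_cells_antipode[of N "{..<d} - dom \<tau>" "face_val N \<tau>" "\<lambda>vs. Q (map lab vs)"]
    by (simp add: face_count_def face_cells_def comp_def rev_map)
qed

definition cube_boundary :: "nat \<Rightarrow> int \<Rightarrow> (nat \<Rightarrow> int) set" where
  "cube_boundary d N = {v. (\<forall>i. \<bar>v i\<bar> \<le> N) \<and> (\<forall>i\<ge>d. v i = 0) \<and> (\<exists>i<d. \<bar>v i\<bar> = N)}"

lemma face_cells_boundary:
  assumes "(x, is) \<in> face_cells d N \<tau>" "v \<in> set (kuhn_path x is)" "dom \<tau> \<subseteq> {..<d}" "dom \<tau> \<noteq> {}" "N > 0"
  shows "v \<in> cube_boundary d N"
proof -
  have x: "distinct is" "set is = {..<d} - dom \<tau>" "\<And>i. i \<in> {..<d} - dom \<tau> \<Longrightarrow> - N \<le> x i \<and> x i < N"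
    "\<And>i. i \<notin> {..<d} - dom \<tau> \<Longrightarrow> x i = face_val N \<tau> i"
    using assms(1) by (auto simp: face_cells_def cells_def)
  have v: "x j \<le> v j \<and> v j \<le> x j + of_bool (j \<in> {..<d} - dom \<tau>)" for j
    using kuhn_path_bounds[OF assms(2) x(1)] x(2) by simp
  have v_out: "v j = face_val N \<tau> j" if "j \<notin> {..<d} - dom \<tau>" for j
    using v[of j] x(4)[OF that] that by (simp del: Diff_iff)
  have "\<bar>v i\<bar> \<le> N" for i
  proof (cases "i \<in> {..<d} - dom \<tau>")
    case True
    then show ?thesis using v[of i] x(3)[of i] by auto
  next
    case False
    then show ?thesis using v_out[of i] \<open>N > 0\<close> by (auto simp: face_val_def split: option.splits)
  qed
  moreover have "v i = 0" if "i \<ge> d" for i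
  proof -
    have "\<tau> i = None" using that assms(3) by (auto simp: domIff)
    then show ?thesis using v_out[of i] that by (simp add: face_val_def)
  qed
  moreover obtain i where i: "i \<in> dom \<tau>" using assms(4) by blast
  then have "i < d" "\<bar>v i\<bar> = N" using assms(3) v_out[of i] \<open>N > 0\<close> by (auto simp: face_val_def)
  ultimately show ?thesis unfolding cube_boundary_def by blast
qed

lemma kuhn_path_close:
  assumes "u \<in> set (kuhn_path x is)" "v \<in> set (kuhn_path x is)" "distinct is"
  shows "\<bar>u i - v i\<bar> \<le> 1"
  using kuhn_path_bounds[OF assms(1,3), of i] kuhn_path_bounds[OF assms(2,3), of i]
  by (auto split: if_splits simp: of_bool_def)

lemma finite_face_cells [simp]: "finite (face_cells d N \<tau>)"
  by (simp add: face_cells_def finite_cells)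

lemma face_count_either:
  "face_count d N lab alt_either \<tau> = face_count d N lab (alt_labels True) \<tau> + face_count d N lab (alt_labels False) \<tau>"
proof -
  let ?A = "\<lambda>c. {(x, is). (x, is) \<in> face_cells d N \<tau> \<and> alt_labels c (map lab (kuhn_path x is))}"
  have "{(x, is). (x, is) \<in> face_cells d N \<tau> \<and> alt_either (map lab (kuhn_path x is))} = ?A True \<union> ?A False" by auto
  moreover have "finite (?A c)" for c by (rule finite_subset[OF _ finite_face_cells[of d N \<tau>]]) auto
  moreover have "?A True \<inter> ?A False = {}" using alt_labels_exclusive[where c = True] by fastforce
  ultimately show ?thesis unfolding face_count_def by (simp add: card_Un_disjoint)
qed

section \<open>Sign words of faces and the descent through the dimensions\<close>

definition word :: "(nat \<rightharpoonup> bool) \<Rightarrow> bool list" where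
  "word \<tau> = map (\<lambda>i. the (\<tau> i)) (sorted_list_of_set (dom \<tau>))"

lemma word_antip: "finite (dom \<tau>) \<Longrightarrow> word (antip \<tau>) = map Not (word \<tau>)"
  unfolding word_def dom_antip by (auto simp: antip_def)

lemma word_restrict:
  assumes "finite (dom \<tau>)" "k < card (dom \<tau>)"
  shows "word (\<tau> |` (- {sorted_list_of_set (dom \<tau>) ! k})) = del k (word \<tau>)"
proof -
  define xs where "xs = sorted_list_of_set (dom \<tau>)"
  have xs: "sorted xs" "distinct xs" "set xs = dom \<tau>" "k < length xs"
    using assms by (simp_all add: xs_def)
  have split: "xs = take k xs @ xs ! k # drop (Suc k) xs" using xs(4) by (rule id_take_nth_drop)
  have "distinct (take k xs @ xs ! k # drop (Suc k) xs)" using xs(2) split by simp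
  then have 1: "distinct (del k xs)" "xs ! k \<notin> set (del k xs)" by (auto simp: del_def)
  have "set xs = insert (xs ! k) (set (del k xs))" unfolding del_def by (subst split) auto
  then have 2: "set (del k xs) = dom \<tau> - {xs ! k}" using 1 xs(3) by auto
  have "sorted_list_of_set (dom \<tau> - {xs ! k}) = del k xs"
    using 1 2 sorted_del[OF xs(1)] by (metis sorted_list_of_set.idem_if_sorted_distinct)
  moreover have "dom (\<tau> |` (- {xs ! k})) = dom \<tau> - {xs ! k}" by auto
  moreover have "map (\<lambda>i. the ((\<tau> |` (- {xs ! k})) i)) (del k xs) = map (\<lambda>i. the (\<tau> i)) (del k xs)"
    using 1 by (auto simp: restrict_map_def)
  ultimately show ?thesis unfolding word_def xs_def[symmetric] by (simp add: map_del)
qed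

text \<open>Freeing the coordinate \<open>i\<close> passes to a face of one dimension more and
  deletes one letter of the word, so the parity of deletions applies to faces too.\<close>

lemma odd_card_word_restrict:
  assumes "finite (dom \<tau>)" "dom \<tau> \<noteq> {}"
  shows "odd (card {i \<in> dom \<tau>. alternating c (word (\<tau> |` (- {i})))}) \<longleftrightarrow>
     alternating c (word \<tau>) \<or> alternating (\<not> c) (word \<tau>)"
proof -
  define xs where "xs = sorted_list_of_set (dom \<tau>)"
  have xs: "distinct xs" "set xs = dom \<tau>" "length xs = card (dom \<tau>)" "length (word \<tau>) = length xs"
    using assms by (simp_all add: xs_def word_def)
  have "{i \<in> dom \<tau>. alternating c (word (\<tau> |` (- {i})))} =
     (!) xs ` {k. k < length xs \<and> alternating c (word (\<tau> |` (- {xs ! k})))}"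
    unfolding xs(2)[symmetric] by (auto simp: in_set_conv_nth)
  also have "card \<dots> = card {k. k < length xs \<and> alternating c (word (\<tau> |` (- {xs ! k})))}"
    by (rule card_image) (use xs(1) in \<open>auto intro!: inj_onI simp: nth_eq_iff_index_eq\<close>)
  also have "{k. k < length xs \<and> alternating c (word (\<tau> |` (- {xs ! k})))} =
     {k. k < length (word \<tau>) \<and> alternating c (del k (word \<tau>))}"
    using word_restrict[OF assms(1), folded xs_def xs(3)] xs(4) by auto
  also have "odd (card \<dots>) \<longleftrightarrow> alternating c (word \<tau>) \<or> alternating (\<not> c) (word \<tau>)"
    by (rule odd_card_del_alternating) (use assms xs in auto)
  finally show ?thesis .
qed


definition faces :: "nat \<Rightarrow> nat \<Rightarrow> (nat \<rightharpoonup> bool) set" where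
  "faces d k = {\<tau>. dom \<tau> \<subseteq> {..<d} \<and> card (dom \<tau>) = k}"

lemma finite_faces: "finite (faces d k)"
proof (rule finite_subset)
  show "faces d k \<subseteq> (\<Union>D\<in>Pow {..<d}. {\<tau>. dom \<tau> = D \<and> ran \<tau> \<subseteq> UNIV})"
    by (auto simp: faces_def)
  show "finite (\<Union>D\<in>Pow {..<d}. {\<tau>. dom \<tau> = D \<and> ran \<tau> \<subseteq> (UNIV :: bool set)})"
  proof (intro finite_UN_I finite_set_of_finite_maps)
    show "finite D" if "D \<in> Pow {..<d}" for D using that by (auto intro: finite_subset)
  qed auto
qed

lemma finite_dom_faces: "\<tau> \<in> faces d k \<Longrightarrow> finite (dom \<tau>)"
  by (auto simp: faces_def intro: finite_subset)

lemma antip_faces [simp]: "antip \<tau> \<in> faces d k \<longleftrightarrow> \<tau> \<in> faces d k"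
  by (simp add: faces_def)

lemma alternating_word_antip:
  "\<tau> \<in> faces d k \<Longrightarrow> alternating c (word (antip \<tau>)) = alternating (\<not> c) (word \<tau>)"
  by (subst word_antip) (simp_all add: alternating_map_Not finite_dom_faces[of \<tau> d k])

text \<open>Incidences of a face with the faces one dimension higher that satisfy \<open>R\<close>,
  summed in both orders.\<close>

lemma double_count_faces:
  fixes p :: "(nat \<rightharpoonup> bool) \<Rightarrow> nat"
  shows "(\<Sum>\<tau> | \<tau> \<in> faces d k \<and> R \<tau>. \<Sum>i\<in>{..<d} - dom \<tau>. \<Sum>c\<in>UNIV. p (\<tau>(i \<mapsto> c))) =
    (\<Sum>\<tau>\<in>faces d (Suc k). p \<tau> * card {i \<in> dom \<tau>. R (\<tau> |` (- {i}))})"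
proof -
  have fin: "finite {\<tau> \<in> faces d k. R \<tau>}" using finite_faces by simp
  let ?L = "SIGMA \<tau>:{\<tau> \<in> faces d k. R \<tau>}. ({..<d} - dom \<tau>) \<times> (UNIV :: bool set)"
  let ?R = "SIGMA \<tau>:faces d (Suc k). {i \<in> dom \<tau>. R (\<tau> |` (- {i}))}"
  have "(\<Sum>\<tau> | \<tau> \<in> faces d k \<and> R \<tau>. \<Sum>i\<in>{..<d} - dom \<tau>. \<Sum>c\<in>UNIV. p (\<tau>(i \<mapsto> c))) =
     (\<Sum>(\<tau>, i, c)\<in>?L. p (\<tau>(i \<mapsto> c)))"
    using fin by (simp add: sum.cartesian_product sum.Sigma split_def)
  also have "\<dots> = (\<Sum>(\<tau>, i)\<in>?R. p \<tau>)"
  proof (rule sum.reindex_bij_witness[where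
        i = "\<lambda>(\<tau>, i). (\<tau> |` (- {i}), i, the (\<tau> i))" and j = "\<lambda>(\<tau>, i, c). (\<tau>(i \<mapsto> c), i)"])
    fix a assume "a \<in> ?L"
    then obtain \<tau> i c where a: "a = (\<tau>, i, c)" "\<tau> \<in> faces d k" "R \<tau>" "i < d" "i \<notin> dom \<tau>" by auto
    have "\<tau> i = None" using a(5) by (simp add: domIff)
    then have *: "(\<tau>(i \<mapsto> c)) |` (- {i}) = \<tau>"
      by (auto simp: restrict_map_def fun_eq_iff)
    then show "(case case a of (\<tau>, i, c) \<Rightarrow> (\<tau>(i \<mapsto> c), i) of (\<tau>, i) \<Rightarrow> (\<tau> |` (- {i}), i, the (\<tau> i))) = a"
      using a by simp
    have "\<tau>(i \<mapsto> c) \<in> faces d (Suc k)" using a finite_dom_faces[OF a(2)] by (auto simp: faces_def)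
    then show "(case a of (\<tau>, i, c) \<Rightarrow> (\<tau>(i \<mapsto> c), i)) \<in> ?R"
      using a * by simp
    show "(case (case a of (\<tau>, i, c) \<Rightarrow> (\<tau>(i \<mapsto> c), i)) of (\<tau>, i) \<Rightarrow> p \<tau>) = (case a of (\<tau>, i, c) \<Rightarrow> p (\<tau>(i \<mapsto> c)))"
      using a by simp
  next
    fix b assume "b \<in> ?R"
    then obtain \<tau> i where b: "b = (\<tau>, i)" "\<tau> \<in> faces d (Suc k)" "i \<in> dom \<tau>" "R (\<tau> |` (- {i}))" by auto
    obtain c where "\<tau> i = Some c" using b(3) by blast
    then have *: "(\<tau> |` (- {i}))(i \<mapsto> the (\<tau> i)) = \<tau>"
      by (auto simp: restrict_map_def fun_eq_iff)
    then show "(case case b of (\<tau>, i) \<Rightarrow> (\<tau> |` (- {i}), i, the (\<tau> i)) of (\<tau>, i, c) \<Rightarrow> (\<tau>(i \<mapsto> c), i)) = b"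
      using b by simp
    have "dom (\<tau> |` (- {i})) = dom \<tau> - {i}" by auto
    then have "\<tau> |` (- {i}) \<in> faces d k" using b finite_dom_faces[OF b(2)] by (auto simp: faces_def)
    moreover have "i < d" using b by (auto simp: faces_def)
    ultimately show "(case b of (\<tau>, i) \<Rightarrow> (\<tau> |` (- {i}), i, the (\<tau> i))) \<in> ?L"
      using b by simp
  qed
  also have "\<dots> = (\<Sum>\<tau>\<in>faces d (Suc k). \<Sum>i | i \<in> dom \<tau> \<and> R (\<tau> |` (- {i})). p \<tau>)"
    by (rule sum.Sigma[symmetric]) (auto simp: finite_faces finite_dom_faces)
  finally show ?thesis by (simp add: mult.commute)
qed

text \<open>These faces replace the nested hemispheres of the classical argument: modulo 2, the
  boundary of the faces for \<open>k\<close> consists of the faces for \<open>k + 1\<close> and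
  their antipodes.\<close>

definition fan_sum :: "nat \<Rightarrow> int \<Rightarrow> ((nat \<Rightarrow> int) \<Rightarrow> nat) \<Rightarrow> nat \<Rightarrow> nat" where
  "fan_sum d N lab k = (\<Sum>\<tau> | \<tau> \<in> faces d k \<and> alternating True (word \<tau>). face_count d N lab alt_either \<tau>)"

lemma even_sum_cong:
  fixes f g :: "'a \<Rightarrow> nat"
  assumes "\<And>x. x \<in> A \<Longrightarrow> even (f x + g x)"
  shows "even (sum f A + sum g A)"
  unfolding sum.distrib[symmetric] by (rule dvd_sum) (use assms in auto)

text \<open>A face with \<open>k + 1\<close> fixed coordinates is a facet of as many faces with alternating word as its own
  word has entries whose deletion leaves an alternating word. This number is odd exactly for
  alternating words, by the lemma that also governs the labels of a simplex.\<close>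
lemma fan_sum_step:
  assumes N: "N > 0" and k: "k < d"
    and odd: "\<And>v. v \<in> cube_boundary d N \<Longrightarrow> lab (\<lambda>i. - v i) = flip (lab v)"
    and compl: "\<And>u v. u \<in> cube_boundary d N \<Longrightarrow> v \<in> cube_boundary d N \<Longrightarrow> \<forall>i. \<bar>u i - v i\<bar> \<le> 1 \<Longrightarrow> lab u \<noteq> flip (lab v)"
  shows "even (fan_sum d N lab k + fan_sum d N lab (Suc k))"
proof -
  let ?p = "\<lambda>c. face_count d N lab (alt_labels c)"
  let ?F = "{\<tau> \<in> faces d k. alternating True (word \<tau>)}"
  let ?G = "\<lambda>c. {\<tau> \<in> faces d (Suc k). alternating c (word \<tau>)}"
  have nonempty: "dom \<tau> \<noteq> {}" "dom \<tau> \<subseteq> {..<d}" if "\<tau> \<in> faces d (Suc k)" for \<tau>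
    using that by (auto simp: faces_def)
  have "even (fan_sum d N lab k + (\<Sum>\<tau>\<in>?F. \<Sum>i\<in>{..<d} - dom \<tau>. \<Sum>c\<in>UNIV. ?p True (\<tau>(i \<mapsto> c))))"
    unfolding fan_sum_def
  proof (rule even_sum_cong)
    fix \<tau> assume "\<tau> \<in> ?F"
    then have "card (dom \<tau>) < card {..<d}" "dom \<tau> \<subseteq> {..<d}" using k by (auto simp: faces_def)
    then have "{..<d} - dom \<tau> \<noteq> {}" by (metis Diff_eq_empty_iff less_irrefl subset_antisym)
    then show "even (face_count d N lab alt_either \<tau> + (\<Sum>i\<in>{..<d} - dom \<tau>. \<Sum>c\<in>UNIV. ?p True (\<tau>(i \<mapsto> c))))"
      by (rule face_count_step[OF _ N])
  qed
  also have "(\<Sum>\<tau>\<in>?F. \<Sum>i\<in>{..<d} - dom \<tau>. \<Sum>c\<in>UNIV. ?p True (\<tau>(i \<mapsto> c))) =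
     (\<Sum>\<tau>\<in>faces d (Suc k). ?p True \<tau> * card {i \<in> dom \<tau>. alternating True (word (\<tau> |` (- {i})))})"
    by (rule double_count_faces)
  finally have 1: "even (fan_sum d N lab k + \<dots>)" .
  have 2: "even ((\<Sum>\<tau>\<in>faces d (Suc k). ?p True \<tau> * card {i \<in> dom \<tau>. alternating True (word (\<tau> |` (- {i})))}) +
      (\<Sum>\<tau>\<in>faces d (Suc k). if alternating True (word \<tau>) \<or> alternating False (word \<tau>) then ?p True \<tau> else 0))"
  proof (rule even_sum_cong)
    fix \<tau> assume t: "\<tau> \<in> faces d (Suc k)"
    show "even (?p True \<tau> * card {i \<in> dom \<tau>. alternating True (word (\<tau> |` (- {i})))} +
      (if alternating True (word \<tau>) \<or> alternating False (word \<tau>) then ?p True \<tau> else 0))"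
      using odd_card_word_restrict[OF finite_dom_faces[OF t] nonempty(1)[OF t], of True] by auto
  qed
  have "(\<Sum>\<tau>\<in>faces d (Suc k). if alternating True (word \<tau>) \<or> alternating False (word \<tau>) then ?p True \<tau> else 0)
     = sum (?p True) (?G True \<union> ?G False)"
    by (subst sum.inter_filter[symmetric]) (auto simp: finite_faces intro!: sum.cong)
  also have "\<dots> = sum (?p True) (?G True) + sum (?p True) (?G False)"
  proof (rule sum.union_disjoint)
    have "\<not> (alternating True (word \<tau>) \<and> alternating False (word \<tau>))" if "\<tau> \<in> faces d (Suc k)" for \<tau>
    proof -
      have "word \<tau> \<noteq> []" using nonempty(1)[OF that] finite_dom_faces[OF that] by (simp add: word_def)
      then show ?thesis using alternating_exclusive[of "word \<tau>" True] by simp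
    qed
    then show "?G True \<inter> ?G False = {}" by blast
  qed (auto simp: finite_faces)
  \<comment> \<open>Antipodes exchange the two kinds of alternating words. By \<open>odd\<close>
    they also flip all labels, and as \<open>compl\<close> excludes complementary pairs, labels
    alternating from \<open>True\<close> become labels alternating from
    \<open>False\<close>.\<close>
  also have "sum (?p True) (?G False) = sum (?p False) (?G True)"
  proof (rule sum.reindex_bij_witness[where i = antip and j = antip])
    fix \<tau> assume t: "\<tau> \<in> ?G False"
    then show "antip (antip \<tau>) = \<tau>" by simp
    show "antip \<tau> \<in> ?G True"
      using t by (simp add: alternating_word_antip[of \<tau> d "Suc k"])
    show "?p False (antip \<tau>) = ?p True \<tau>"
      unfolding face_count_antip unfolding face_count_def
    proof (intro arg_cong[where f = card] Collect_cong, clarsimp, intro conj_cong refl)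
      fix x "is" assume xs: "(x, is) \<in> face_cells d N \<tau>"
      let ?vs = "kuhn_path x is"
      have bd: "v \<in> cube_boundary d N" if "v \<in> set ?vs" for v
        using face_cells_boundary[OF xs that] nonempty t N by auto
      have "alt_labels False (rev (map (\<lambda>v. lab (\<lambda>j. - v j)) ?vs)) = alt_labels False (map flip (map lab ?vs))"
        by (rule alt_labels_mset_cong) (use bd odd in \<open>auto intro!: image_mset_cong\<close>)
      also have "\<dots> = alt_labels True (map lab ?vs)"
      proof (subst alt_labels_map_flip)
        fix m n assume "m \<in> set (map lab ?vs)" "n \<in> set (map lab ?vs)"
        then obtain u v where "u \<in> set ?vs" "v \<in> set ?vs" "m = lab u" "n = lab v" by auto
        moreover have "distinct is" using xs by (auto simp: face_cells_def cells_def)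
        ultimately show "m \<noteq> flip n" using compl bd kuhn_path_close by metis
      qed simp
      finally show "alt_labels False (rev (map (\<lambda>v. lab (\<lambda>j. - v j)) ?vs)) = alt_labels True (map lab ?vs)" .
    qed
  next
    fix \<tau> assume t: "\<tau> \<in> ?G True"
    then show "antip (antip \<tau>) = \<tau>" by simp
    show "antip \<tau> \<in> ?G False"
      using t by (simp add: alternating_word_antip[of \<tau> d "Suc k"])
  qed
  also have "sum (?p True) (?G True) + sum (?p False) (?G True) = fan_sum d N lab (Suc k)"
    unfolding fan_sum_def face_count_either by (simp add: sum.distrib)
  finally show ?thesis using 1 2 by (metis (no_types, lifting) even_add)
qed

section \<open>Parity of the count for antipodal and for symmetric boundary labels\<close>

lemma alternating_nth: "alternating c bs \<longleftrightarrow> (\<forall>i<length bs. bs ! i = (even i = c))"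
  by (induction bs arbitrary: c) (auto simp: All_less_Suc2)

lemma card_singleton_filter: "R a b \<Longrightarrow> card {(x, y). (x, y) \<in> {(a, b)} \<and> R x y} = 1"
proof -
  assume "R a b"
  then have "{(x, y). (x, y) \<in> {(a, b)} \<and> R x y} = {(a, b)}" by auto
  then show ?thesis by simp
qed

text \<open>Only one sign pattern on all \<open>d\<close> coordinates alternates from
  \<open>True\<close>. Its face is a single vertex, and a list of one label always alternates in one
  of the two senses.\<close>

lemma odd_fan_sum_top: "odd (fan_sum d N lab d)"
proof -
  define \<tau>0 where "\<tau>0 = (\<lambda>i. if i < d then Some (even i) else None)"
  have "{\<tau> \<in> faces d d. alternating True (word \<tau>)} = {\<tau>0}"
  proof (intro set_eqI iffI)
    fix \<tau> assume "\<tau> \<in> {\<tau> \<in> faces d d. alternating True (word \<tau>)}"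
    then have dom: "dom \<tau> = {..<d}" and a: "alternating True (word \<tau>)"
      using card_subset_eq[of "{..<d}" "dom \<tau>"] by (auto simp: faces_def)
    have srt: "sorted_list_of_set {..<d} = [0..<d]" by (simp add: lessThan_atLeast0)
    have the: "the (\<tau> i) = even i" if "i < d" for i
      using a that unfolding word_def dom srt alternating_nth by simp
    have "\<tau> i = \<tau>0 i" for i
    proof (cases "i < d")
      case True
      then obtain c where "\<tau> i = Some c" using dom by blast
      then show ?thesis using the[OF True] True by (simp add: \<tau>0_def)
    next
      case False
      then have "i \<notin> dom \<tau>" using dom by simp
      then show ?thesis using False by (simp add: \<tau>0_def domIff)
    qed
    then show "\<tau> \<in> {\<tau>0}" by blast
  next
    fix \<tau> assume "\<tau> \<in> {\<tau>0}"
    then have t: "\<tau> = \<tau>0" by simp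
    have dom: "dom \<tau>0 = {..<d}" by (auto simp: \<tau>0_def split: if_splits)
    have srt: "sorted_list_of_set {..<d} = [0..<d]" by (simp add: lessThan_atLeast0)
    have "alternating True (word \<tau>0)"
      unfolding word_def dom srt alternating_nth by (simp add: \<tau>0_def)
    then show "\<tau> \<in> {\<tau> \<in> faces d d. alternating True (word \<tau>)}"
      unfolding t by (simp add: faces_def dom)
  qed
  moreover have "face_count d N lab alt_either \<tau>0 = 1"
  proof -
    have dom: "dom \<tau>0 = {..<d}" by (auto simp: \<tau>0_def split: if_splits)
    have cell: "face_cells d N \<tau>0 = {(face_val N \<tau>0, [])}"
      by (auto simp: face_cells_def cells_def dom)
    have alt: "alt_either (map lab (kuhn_path (face_val N \<tau>0) []))"
      by (simp add: alt_labels_def)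
    show ?thesis
      unfolding face_count_def cell
      using card_singleton_filter[of "\<lambda>x is. alt_either (map lab (kuhn_path x is))", OF alt] .
  qed
  ultimately show ?thesis by (simp add: fan_sum_def)
qed

text \<open>The parity of \<open>fan_sum\<close> is carried from the single vertex at
  \<open>k = d\<close> down to \<open>k = 0\<close>, where the only face is the cube itself.\<close>

lemma odd_face_count_odd:
  assumes N: "N > 0"
    and odd: "\<And>v. v \<in> cube_boundary d N \<Longrightarrow> lab (\<lambda>i. - v i) = flip (lab v)"
    and compl: "\<And>u v. u \<in> cube_boundary d N \<Longrightarrow> v \<in> cube_boundary d N \<Longrightarrow> \<forall>i. \<bar>u i - v i\<bar> \<le> 1 \<Longrightarrow> lab u \<noteq> flip (lab v)"
  shows "odd (face_count d N lab alt_either Map.empty)"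
proof -
  have "odd (fan_sum d N lab (d - j))" if "j \<le> d" for j
    using that
  proof (induction j)
    case 0
    then show ?case using odd_fan_sum_top by simp
  next
    case (Suc j)
    then have "even (fan_sum d N lab (d - Suc j) + fan_sum d N lab (Suc (d - Suc j)))"
      by (intro fan_sum_step) (auto simp: N odd dest: compl)
    then show ?case using Suc by (simp add: Suc_diff_Suc)
  qed
  from this[of d] have "odd (fan_sum d N lab 0)" by simp
  moreover have "{\<tau> \<in> faces d 0. alternating True (word \<tau>)} = {Map.empty}"
    by (auto simp: faces_def word_def dest: finite_subset)
  ultimately show ?thesis by (simp add: fan_sum_def)
qed

text \<open>One boundary step suffices: opposite facets of the cube carry the same labels up to
  reflection, so their contributions are equal and cancel modulo 2.\<close>

lemma even_face_count_even:
  assumes N: "N > 0" and d: "d > 0"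
    and even: "\<And>v. v \<in> cube_boundary d N \<Longrightarrow> lab (\<lambda>i. - v i) = lab v"
  shows "even (face_count d N lab alt_either Map.empty)"
proof -
  let ?p = "face_count d N lab (alt_labels True)"
  have "?p [i \<mapsto> \<not> c] = ?p [i \<mapsto> c]" if "i < d" for i c
  proof -
    have "antip [i \<mapsto> c] = [i \<mapsto> \<not> c]" by (auto simp: antip_def)
    then have "?p [i \<mapsto> \<not> c] = card {(x, is). (x, is) \<in> face_cells d N [i \<mapsto> c] \<and>
       alt_labels True (rev (map (\<lambda>v. lab (\<lambda>j. - v j)) (kuhn_path x is)))}"
      using face_count_antip[of d N lab "alt_labels True" "[i \<mapsto> c]"] by simp
    also have "\<dots> = ?p [i \<mapsto> c]"
      unfolding face_count_def
    proof (intro arg_cong[where f = card] Collect_cong, clarsimp, intro conj_cong refl)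
      fix x "is" assume xs: "(x, is) \<in> face_cells d N [i \<mapsto> c]"
      have bd: "v \<in> cube_boundary d N" if "v \<in> set (kuhn_path x is)" for v
        using face_cells_boundary[OF xs that] N \<open>i < d\<close> by auto
      show "alt_labels True (rev (map (\<lambda>v. lab (\<lambda>j. - v j)) (kuhn_path x is))) = alt_labels True (map lab (kuhn_path x is))"
        by (rule alt_labels_mset_cong) (use bd even in \<open>auto intro!: image_mset_cong\<close>)
    qed
    finally show ?thesis .
  qed
  then have "?p [i \<mapsto> False] = ?p [i \<mapsto> True]" if "i < d" for i
    using that by (metis (full_types))
  then have "even (\<Sum>c\<in>UNIV. ?p [i \<mapsto> c])" if "i < d" for i
    using that by (simp add: UNIV_bool)
  then have "even (\<Sum>i<d. \<Sum>c\<in>UNIV. ?p [i \<mapsto> c])" by (rule dvd_sum) auto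
  moreover have "even (face_count d N lab alt_either Map.empty + (\<Sum>i<d. \<Sum>c\<in>UNIV. ?p [i \<mapsto> c]))"
    using face_count_step[of d Map.empty N lab] N d by auto
  ultimately show ?thesis by simp
qed

text \<open>The alternating simplices of the cube of radius \<open>N\<close> are odd in number,
  those of radius \<open>M\<close> even, so one of the former lies outside the smaller cube. Its
  \<open>d + 1\<close> labels are too many to alternate without a complementary pair.\<close>

theorem annulus_complementary_edge:
  fixes lab :: "(nat \<Rightarrow> int) \<Rightarrow> nat"
  assumes d: "d > 0" and MN: "0 < M" "M \<le> N"
    and range: "\<And>v. lab v < 2 * d"
    and odd: "\<And>v. v \<in> cube_boundary d N \<Longrightarrow> lab (\<lambda>i. - v i) = flip (lab v)"
    and even: "\<And>v. v \<in> cube_boundary d M \<Longrightarrow> lab (\<lambda>i. - v i) = lab v"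
  obtains u v where "\<And>i. \<bar>u i - v i\<bar> \<le> 1" "lab u = flip (lab v)"
    "\<And>w. w \<in> {u, v} \<Longrightarrow> (\<forall>i. \<bar>w i\<bar> \<le> N) \<and> (\<exists>i<d. \<bar>w i\<bar> \<ge> M)"
proof -
  let ?near = "\<lambda>u v. \<forall>i. \<bar>u i - v i\<bar> \<le> 1"
  define ann where "ann = {w. (\<forall>i. \<bar>w i\<bar> \<le> N) \<and> (\<exists>i<d. \<bar>w i\<bar> \<ge> M)}"
  have bd: "cube_boundary d N \<subseteq> ann" using MN by (auto simp: cube_boundary_def ann_def)
  have "\<exists>u\<in>ann. \<exists>v\<in>ann. ?near u v \<and> lab u = flip (lab v)"
  proof (rule ccontr)
    assume neg: "\<not> ?thesis"
    have no_edge: "lab u \<noteq> flip (lab v)" if "u \<in> ann" "v \<in> ann" "?near u v" for u v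
      using neg that by blast
    have "odd (face_count d N lab alt_either Map.empty)"
    proof (rule odd_face_count_odd)
      show "0 < N" using MN by simp
      show "lab u \<noteq> flip (lab v)" if "u \<in> cube_boundary d N" "v \<in> cube_boundary d N" "?near u v" for u v
        using that bd by (intro no_edge) auto
    qed (rule odd)
    moreover have "even (face_count d M lab alt_either Map.empty)"
      by (rule even_face_count_even) (use MN even d in auto)
    ultimately have "{(x, is). (x, is) \<in> face_cells d N Map.empty \<and> alt_either (map lab (kuhn_path x is))} \<noteq>
       {(x, is). (x, is) \<in> face_cells d M Map.empty \<and> alt_either (map lab (kuhn_path x is))}"
      unfolding face_count_def by metis
    moreover have "face_cells d M Map.empty \<subseteq> face_cells d N Map.empty"
    proof -
      have "- N \<le> k \<and> k < N" if "- M \<le> k" "k < M" for k using that MN by linarith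
      then show ?thesis by (auto simp: face_cells_def cells_def face_val_def)
    qed
    ultimately obtain x "is" where xN: "(x, is) \<in> face_cells d N Map.empty"
      and xM: "(x, is) \<notin> face_cells d M Map.empty" and alt: "alt_either (map lab (kuhn_path x is))"
      by blast
    have xs: "distinct is" "set is = {..<d}" "\<And>i. i < d \<Longrightarrow> - N \<le> x i \<and> x i < N" "\<And>i. i \<ge> d \<Longrightarrow> x i = 0"
      using xN by (auto simp: face_cells_def cells_def face_val_def)
    \<comment> \<open>Since \<open>M\<close> is an integer, no grid simplex crosses the hyperplanes
      where a coordinate is \<open>M\<close> or \<open>- M\<close>. Thus this one coordinate puts
      all vertices of the simplex into the annulus.\<close>
    then obtain i where i: "i < d" "x i < - M \<or> M \<le> x i"
      using xM by (force simp: face_cells_def cells_def face_val_def)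
    have in_ann: "v \<in> ann" if "v \<in> set (kuhn_path x is)" for v
    proof -
      have v: "x j \<le> v j \<and> v j \<le> x j + of_bool (j < d)" for j
        using kuhn_path_bounds[OF that xs(1), of j] xs(2) by simp
      have "\<bar>v j\<bar> \<le> N" for j
        using v[of j] xs(3,4)[of j] MN by (cases "j < d") auto
      moreover have "\<bar>v i\<bar> \<ge> M" using v[of i] i by auto
      ultimately show ?thesis using i(1) by (auto simp: ann_def)
    qed
    define ls where "ls = sort (map lab (kuhn_path x is))"
    have "length ls \<le> d"
    proof -
      have no: "m \<noteq> flip n" if "m \<in> set ls" "n \<in> set ls" for m n
      proof -
        from that obtain u v where uv: "u \<in> set (kuhn_path x is)" "v \<in> set (kuhn_path x is)" "m = lab u" "n = lab v"
          by (auto simp: ls_def)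
        have "?near u v" using kuhn_path_close[OF uv(1,2) xs(1)] by simp
        then show ?thesis unfolding uv(3,4) by (rule no_edge[OF in_ann[OF uv(1)] in_ann[OF uv(2)]])
      qed
      have sm: "sorted ls" "\<And>m. m \<in> set ls \<Longrightarrow> m < 2 * d" using range by (auto simp: ls_def)
      from alt obtain c where "alternating c (map even ls)" unfolding alt_labels_def ls_def by blast
      from alternating_pigeonhole[OF this sm(1) no sm(2)] show ?thesis by blast
    qed
    moreover have "length ls = Suc d" using distinct_card[OF xs(1)] xs(2) by (simp add: ls_def)
    ultimately show False by simp
  qed
  then show thesis using that unfolding ann_def by blast
qed

section \<open>Maps on the annulus\<close>

lemma infnorm_cart_le_iff: "infnorm (x :: real^'n) \<le> b \<longleftrightarrow> (\<forall>i. \<bar>x $ i\<bar> \<le> b)"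
proof
  assume "\<forall>i. \<bar>x $ i\<bar> \<le> b"
  then show "infnorm x \<le> b"
    unfolding infnorm_cart by (intro cSup_least) auto
qed (meson component_le_infnorm_cart order_trans)

lemma infnorm_cart_ge_iff: "b \<le> infnorm (x :: real^'n) \<longleftrightarrow> (\<exists>i. b \<le> \<bar>x $ i\<bar>)"
proof
  assume b: "b \<le> infnorm x"
  show "\<exists>i. b \<le> \<bar>x $ i\<bar>"
  proof (rule ccontr)
    assume "\<not> ?thesis"
    then have lt: "\<bar>x $ i\<bar> < b" for i by (simp add: not_le)
    have "infnorm x \<le> Max (range (\<lambda>i. \<bar>x $ i\<bar>))" unfolding infnorm_cart_le_iff by simp
    also have "\<dots> < b" using lt by simp
    finally show False using b by simp
  qed
qed (meson component_le_infnorm_cart order_trans)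

lemma flip_eq:
  fixes a b :: nat
  assumes "2 * a + of_bool P = flip (2 * b + of_bool Q)"
  shows "a = b \<and> P \<noteq> Q"
  using assms by (cases P; cases Q; simp add: flip_def; presburger)

text \<open>By compactness a zero-free \<open>G\<close> has everywhere a component of size at least
  some \<open>e > 0\<close>; its index and sign label the grid points. A complementary edge joins
  two close points at which one component has size at least \<open>e\<close> and opposite signs,
  against uniform continuity.\<close>

theorem annulus_zero:
  fixes G :: "real^'d \<Rightarrow> real^'d"
  assumes cont: "continuous_on {y. 1 \<le> infnorm y \<and> infnorm y \<le> 2} G"
    and odd: "\<And>y. infnorm y = 2 \<Longrightarrow> G (- y) = - G y"
    and even: "\<And>y. infnorm y = 1 \<Longrightarrow> G (- y) = G y"
  obtains y where "1 \<le> infnorm y" "infnorm y \<le> 2" "G y = 0"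
proof -
  define A where "A = {y :: real^'d. 1 \<le> infnorm y \<and> infnorm y \<le> 2}"
  define d where "d = CARD('d)"
  have d: "d > 0" by (simp add: d_def)
  have contA: "continuous_on A G" using cont by (simp add: A_def)
  have "closed A"
    unfolding A_def by (intro closed_Collect_conj closed_Collect_le continuous_intros)
  moreover have "bounded A"
  proof (rule boundedI)
    fix y assume "y \<in> A"
    have "norm y \<le> sqrt DIM(real^'d) * infnorm y" by (rule norm_le_infnorm)
    also have "\<dots> \<le> sqrt DIM(real^'d) * 2"
      using \<open>y \<in> A\<close> by (intro mult_left_mono) (auto simp: A_def)
    finally show "norm y \<le> sqrt DIM(real^'d) * 2" .
  qed
  ultimately have compA: "compact A" by (simp add: compact_eq_bounded_closed)
  have "\<exists>y\<in>A. G y = 0"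
  proof (rule ccontr)
    assume "\<not> ?thesis"
    then have nz: "\<And>y. y \<in> A \<Longrightarrow> G y \<noteq> 0" by blast
    obtain e where e: "e > 0" "\<And>y. y \<in> A \<Longrightarrow> \<exists>i. e \<le> \<bar>G y $ i\<bar>"
    proof (cases "A = {}")
      case True
      then show ?thesis using that[of 1] by simp
    next
      case False
      have "continuous_on A (\<lambda>y. infnorm (G y))" using contA by (intro continuous_intros)
      from continuous_attains_inf[OF compA False this]
      obtain y0 where y0: "y0 \<in> A" "\<And>y. y \<in> A \<Longrightarrow> infnorm (G y0) \<le> infnorm (G y)" by blast
      then have "infnorm (G y0) > 0" using nz by (simp add: infnorm_pos_lt)
      then show ?thesis using that y0 infnorm_cart_ge_iff by metis
    qed
    have "uniformly_continuous_on A G" using contA compA compact_uniformly_continuous by blast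
    then obtain r where r: "r > 0" "\<And>y z. y \<in> A \<Longrightarrow> z \<in> A \<Longrightarrow> dist z y < r \<Longrightarrow> dist (G z) (G y) < e"
      using e(1) unfolding uniformly_continuous_on_def by metis
    \<comment> \<open>An edge of the grid of mesh \<open>1 / m\<close> changes each of the
      \<open>d\<close> coordinates by at most \<open>1 / m\<close>, hence has length at most
      \<open>d / m < r\<close>.\<close>
    obtain m where m: "real d / r < real m" using reals_Archimedean2 by blast
    then have m0: "m > 0" using r(1) d by (cases m) (auto simp: field_simps)
    obtain f :: "nat \<Rightarrow> 'd" where f: "bij_betw f {..<d} UNIV"
      using ex_bij_betw_nat_finite[of "UNIV :: 'd set"] by (auto simp: d_def lessThan_atLeast0)
    define g where "g = inv_into {..<d} f"
    have g: "g i < d" "f (g i) = i" for i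
      using f inv_into_into[of i f "{..<d}"] f_inv_into_f[of i f "{..<d}"] by (auto simp: g_def bij_betw_def)
    have gf: "g (f k) = k" if "k < d" for k
      using f that unfolding g_def by (intro inv_into_f_f) (auto simp: bij_betw_def)
    \<comment> \<open>This scaling turns the integer cubes of radius \<open>m\<close> and
      \<open>2 * m\<close> into those of sup-norm 1 and 2.\<close>
    define pt :: "(nat \<Rightarrow> int) \<Rightarrow> real^'d" where "pt = (\<lambda>v. \<chi> i. of_int (v (g i)) / real m)"
    have pt_neg: "pt (\<lambda>i. - v i) = - pt v" for v by (simp add: pt_def vec_eq_iff)
    have pt_le: "infnorm (pt v) \<le> c" if "\<And>i. i < d \<Longrightarrow> \<bar>v i\<bar> \<le> c * int m" for v and c :: int
    proof -
      have "real_of_int \<bar>v (g i)\<bar> \<le> real_of_int (c * int m)" for i using that[OF g(1)] of_int_le_iff by blast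
      then show ?thesis unfolding infnorm_cart_le_iff using m0 by (simp add: pt_def field_simps)
    qed
    have pt_ge: "c \<le> infnorm (pt v)" if "i < d" "\<bar>v i\<bar> \<ge> c * int m" for v i and c :: int
    proof -
      have "real_of_int \<bar>v i\<bar> \<ge> real_of_int (c * int m)" using that of_int_le_iff by blast
      then have "c \<le> \<bar>pt v $ f i\<bar>" using m0 gf[OF that(1)] by (simp add: pt_def field_simps)
      then show ?thesis using component_le_infnorm_cart order_trans by blast
    qed
    define big where "big = (\<lambda>y k. k < d \<and> e \<le> \<bar>G y $ f k\<bar>)"
    \<comment> \<open>Inside the inner cube no component need be large; the default 0 keeps every
      label below \<open>2 * d\<close> there.\<close>
    define ix where "ix = (\<lambda>y. if \<exists>k. big y k then LEAST k. big y k else 0)"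
    define lab where "lab = (\<lambda>v. 2 * ix (pt v) + of_bool (G (pt v) $ f (ix (pt v)) < 0))"
    have big_ix: "big y (ix y)" if "y \<in> A" for y
    proof -
      from e(2)[OF that] obtain i where "e \<le> \<bar>G y $ i\<bar>" by blast
      then have "big y (g i)" using g by (simp add: big_def)
      then have "\<exists>k. big y k" by blast
      then show ?thesis using LeastI_ex[of "big y"] by (simp add: ix_def)
    qed
    have lab_range: "lab v < 2 * d" for v
    proof -
      have "ix (pt v) < d"
      proof (cases "\<exists>k. big (pt v) k")
        case True
        then show ?thesis using LeastI_ex[of "big (pt v)"] by (simp add: ix_def big_def)
      next
        case False
        then have "ix (pt v) = 0" unfolding ix_def by (rule if_not_P)
        then show ?thesis using d by simp
      qed
      then show ?thesis by (simp add: lab_def)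
    qed
    have bdry: "infnorm (pt v) = c" if "v \<in> cube_boundary d (c * int m)" for v and c :: int
      using that pt_le[of v c] pt_ge[of _ c v] by (force simp: cube_boundary_def)
    have odd_lab: "lab (\<lambda>i. - v i) = flip (lab v)" if "v \<in> cube_boundary d (2 * int m)" for v
    proof -
      have v: "infnorm (pt v) = 2" using bdry[of v 2] that by simp
      then have "pt v \<in> A" by (simp add: A_def)
      then have "G (pt v) $ f (ix (pt v)) \<noteq> 0" using big_ix e(1) by (fastforce simp: big_def)
      moreover have "big (- pt v) = big (pt v)" using odd[OF v] by (simp add: big_def fun_eq_iff)
      then have "ix (- pt v) = ix (pt v)" by (simp only: ix_def)
      ultimately show ?thesis using odd[OF v] by (auto simp: lab_def pt_neg flip_def)
    qed
    have even_lab: "lab (\<lambda>i. - v i) = lab v" if "v \<in> cube_boundary d (int m)" for v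
    proof -
      have v: "infnorm (pt v) = 1" using bdry[of v 1] that by simp
      have "big (- pt v) = big (pt v)" using even[OF v] by (simp add: big_def fun_eq_iff)
      then have "ix (- pt v) = ix (pt v)" by (simp only: ix_def)
      then show ?thesis using even[OF v] by (simp add: lab_def pt_neg)
    qed
    obtain u v where uv: "\<And>i. \<bar>u i - v i\<bar> \<le> 1" "lab u = flip (lab v)"
      "\<And>w. w \<in> {u, v} \<Longrightarrow> (\<forall>i. \<bar>w i\<bar> \<le> 2 * int m) \<and> (\<exists>i<d. \<bar>w i\<bar> \<ge> int m)"
      using annulus_complementary_edge[of d "int m" "2 * int m" lab] d m0 lab_range odd_lab even_lab by auto
    have inA: "pt w \<in> A" if "w \<in> {u, v}" for w
      using uv(3)[OF that] pt_le[of w 2] pt_ge[of _ 1 w] by (auto simp: A_def)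
    have "norm (pt u - pt v) \<le> (\<Sum>i\<in>UNIV. \<bar>(pt u - pt v) $ i\<bar>)" by (rule norm_le_l1_cart)
    also have "\<dots> \<le> (\<Sum>i\<in>(UNIV :: 'd set). 1 / real m)"
    proof (rule sum_mono)
      fix i
      have "\<bar>(pt u - pt v) $ i\<bar> = real_of_int \<bar>u (g i) - v (g i)\<bar> / real m"
        by (simp add: pt_def diff_divide_distrib[symmetric])
      also have "\<dots> \<le> 1 / real m"
        using uv(1)[of "g i"] by (intro divide_right_mono) linarith+
      finally show "\<bar>(pt u - pt v) $ i\<bar> \<le> 1 / real m" .
    qed
    also have "\<dots> < r" using m m0 r(1) by (simp add: d_def field_simps)
    finally have near: "norm (G (pt u) - G (pt v)) < e"
      using r(2)[OF inA[of v] inA[of u]] by (simp add: dist_norm)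
    have same: "ix (pt u) = ix (pt v)" "(G (pt u) $ f (ix (pt u)) < 0) \<noteq> (G (pt v) $ f (ix (pt v)) < 0)"
      using flip_eq[OF uv(2)[unfolded lab_def]] by auto
    define k where "k = f (ix (pt u))"
    have "e \<le> \<bar>G (pt u) $ k\<bar>" "e \<le> \<bar>G (pt v) $ k\<bar>" "(G (pt u) $ k < 0) \<noteq> (G (pt v) $ k < 0)"
      using big_ix[OF inA[of u]] big_ix[OF inA[of v]] same by (auto simp: big_def k_def)
    then have "e \<le> \<bar>(G (pt u) - G (pt v)) $ k\<bar>" by (auto split: abs_split)
    also have "\<dots> \<le> norm (G (pt u) - G (pt v))" by (rule component_le_norm_cart)
    finally show False using near by simp
  qed
  then show thesis using that by (auto simp: A_def)
qed

section \<open>Mass of half-spaces\<close>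

text \<open>Dominated convergence of indicator functions. All continuity statements below reduce to
  it, the exceptional points being those on bounding hyperplanes.\<close>

lemma measure_tendsto_of_AE:
  assumes "finite_measure M" and A: "\<And>n. A n \<in> sets M" "B \<in> sets M"
    and ae: "AE x in M. \<forall>\<^sub>F n in sequentially. x \<in> A n \<longleftrightarrow> x \<in> B"
  shows "(\<lambda>n. measure M (A n)) \<longlonglongrightarrow> measure M B"
proof -
  interpret finite_measure M by fact
  have "(\<lambda>n. integral\<^sup>L M (indicator (A n) :: _ \<Rightarrow> real)) \<longlonglongrightarrow> integral\<^sup>L M (indicator B)"
  proof (rule integral_dominated_convergence[where w = "\<lambda>_. 1"])
    show "AE x in M. (\<lambda>n. indicator (A n) x :: real) \<longlonglongrightarrow> indicator B x"
      using ae
    proof eventually_elim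
      case (elim x)
      then show ?case
        by (intro tendsto_eventually) (auto elim!: eventually_mono simp: indicator_def)
    qed
  qed (use A in \<open>auto simp: indicator_def\<close>)
  then show ?thesis using A by simp
qed

locale ac_measure =
  fixes M :: "'a::euclidean_space measure"
  assumes finite_M: "finite_measure M"
    and sets_M [measurable_cong]: "sets M = sets borel"
    and ac: "absolutely_continuous lborel M"
begin

sublocale finite_measure M by (rule finite_M)

lemma space_M [simp]: "space M = UNIV"
  using sets_eq_imp_space_eq[OF sets_M] by simp

lemma sets_inner [measurable]:
  "{x. v \<bullet> x = a} \<in> sets M" "{x. v \<bullet> x \<le> a} \<in> sets M" "{x. a \<le> v \<bullet> x} \<in> sets M" "{x. a < v \<bullet> x} \<in> sets M"
  unfolding sets_M by measurable

lemma hyperplane_null: "v \<noteq> 0 \<Longrightarrow> {x. v \<bullet> x = a} \<in> null_sets M"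
proof -
  assume v: "v \<noteq> 0"
  have "{x. v \<bullet> x = a} \<in> null_sets lborel"
    using negligible_hyperplane[of v a] v
    by (auto simp: negligible_iff_null_sets null_sets_def)
  then show ?thesis using ac by (auto simp: absolutely_continuous_def)
qed

lemma AE_not_hyperplane: "v \<noteq> 0 \<Longrightarrow> AE x in M. v \<bullet> x \<noteq> a"
  by (rule AE_I'[OF hyperplane_null[of v a]]) auto

end

text \<open>The distribution function of the linear form given by \<open>y\<close> under
  \<open>M\<close>.\<close>

definition half_mass :: "'a::euclidean_space measure \<Rightarrow> 'a \<Rightarrow> real \<Rightarrow> real" where
  "half_mass M y r = measure M {z. y \<bullet> z \<le> r}"

context ac_measure
begin

text \<open>Joint continuity in direction and level: off the limiting hyperplane, a null set, the
  strict inequality at the limit persists for large \<open>n\<close>.\<close>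

lemma half_mass_tendsto:
  assumes y: "Y \<longlonglongrightarrow> y" "y \<noteq> 0" and r: "R \<longlonglongrightarrow> r"
  shows "(\<lambda>n. half_mass M (Y n) (R n)) \<longlonglongrightarrow> half_mass M y r"
  unfolding half_mass_def
proof (rule measure_tendsto_of_AE[OF finite_M])
  show "AE x in M. \<forall>\<^sub>F n in sequentially. x \<in> {z. Y n \<bullet> z \<le> R n} \<longleftrightarrow> x \<in> {z. y \<bullet> z \<le> r}"
    using AE_not_hyperplane[OF y(2), of r]
  proof eventually_elim
    case (elim x)
    have lim: "(\<lambda>n. Y n \<bullet> x - R n) \<longlonglongrightarrow> y \<bullet> x - r" by (intro tendsto_intros y r)
    show ?case
    proof (cases "y \<bullet> x < r")
      case True
      then have "\<forall>\<^sub>F n in sequentially. Y n \<bullet> x - R n < 0" using True order_tendstoD(2)[OF lim, of 0] by simp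
      then show ?thesis by eventually_elim (use True in auto)
    next
      case False
      then have "\<forall>\<^sub>F n in sequentially. Y n \<bullet> x - R n > 0" using False elim order_tendstoD(1)[OF lim, of 0] by simp
      then show ?thesis by eventually_elim (use False elim in auto)
    qed
  qed
qed auto

lemma half_mass_nonneg: "0 \<le> half_mass M y r"
  by (simp add: half_mass_def)

lemma half_mass_le: "half_mass M y r \<le> measure M UNIV"
  unfolding half_mass_def using bounded_measure[of "{z. y \<bullet> z \<le> r}"] by simp

lemma half_mass_mono: "r \<le> s \<Longrightarrow> half_mass M y r \<le> half_mass M y s"
  unfolding half_mass_def by (intro finite_measure_mono) auto

lemma half_mass_uminus:
  assumes "y \<noteq> 0"
  shows "half_mass M (- y) (- r) = measure M UNIV - half_mass M y r"
proof -
  have "half_mass M (- y) (- r) = measure M {z. r \<le> y \<bullet> z}" by (simp add: half_mass_def)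
  also have "\<dots> = measure M {z. r < y \<bullet> z}"
    using AE_not_hyperplane[OF assms, of r] by (intro finite_measure_eq_AE) auto
  also have "{z. r < y \<bullet> z} = space M - {z. y \<bullet> z \<le> r}" by auto
  also have "measure M \<dots> = measure M UNIV - half_mass M y r"
    by (subst finite_measure_compl) (auto simp: half_mass_def)
  finally show ?thesis .
qed

lemma half_mass_at_top: "(half_mass M y \<longlongrightarrow> measure M UNIV) at_top"
proof (rule tendsto_at_topI_sequentially)
  fix X :: "nat \<Rightarrow> real" assume X: "filterlim X at_top sequentially"
  show "(\<lambda>n. half_mass M y (X n)) \<longlonglongrightarrow> measure M UNIV"
    unfolding half_mass_def
  proof (rule measure_tendsto_of_AE[OF finite_M])
    show "AE x in M. \<forall>\<^sub>F n in sequentially. x \<in> {z. y \<bullet> z \<le> X n} \<longleftrightarrow> x \<in> UNIV"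
      using X by (auto simp: filterlim_at_top)
  qed (auto simp: sets_M)
qed

lemma half_mass_at_bot: "(half_mass M y \<longlongrightarrow> 0) at_bot"
proof (rule tendsto_at_botI_sequentially)
  fix X :: "nat \<Rightarrow> real" assume X: "filterlim X at_bot sequentially"
  have "(\<lambda>n. half_mass M y (X n)) \<longlonglongrightarrow> measure M {}"
    unfolding half_mass_def
  proof (rule measure_tendsto_of_AE[OF finite_M])
    have "\<forall>\<^sub>F n in sequentially. X n < y \<bullet> x" for x using X by (simp add: filterlim_at_bot_dense)
    then show "AE x in M. \<forall>\<^sub>F n in sequentially. x \<in> {z. y \<bullet> z \<le> X n} \<longleftrightarrow> x \<in> {}"
      by (auto simp: not_le)
  qed auto
  then show "(\<lambda>n. half_mass M y (X n)) \<longlonglongrightarrow> 0" by simp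
qed

end

locale full_measure = ac_measure +
  assumes full: "open U \<Longrightarrow> U \<noteq> {} \<Longrightarrow> measure M U > 0"
begin

lemma half_mass_strict_mono:
  assumes "y \<noteq> 0" "r < s"
  shows "half_mass M y r < half_mass M y s"
proof -
  let ?U = "{z. r < y \<bullet> z \<and> y \<bullet> z < s}"
  have "open ?U" by (intro open_Collect_conj open_Collect_less continuous_intros)
  moreover have "((r + s) / 2 / (y \<bullet> y)) *\<^sub>R y \<in> ?U" using assms by (simp add: field_simps)
  then have "?U \<noteq> {}" by blast
  ultimately have pos: "measure M ?U > 0" by (rule full)
  have U: "?U \<in> sets M" unfolding sets_M by measurable
  have "half_mass M y r + measure M ?U = measure M ({z. y \<bullet> z \<le> r} \<union> ?U)"
    unfolding half_mass_def by (rule finite_measure_Union[symmetric]) (use U in auto)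
  also have "\<dots> \<le> half_mass M y s"
    unfolding half_mass_def by (rule finite_measure_mono) (use assms in auto)
  finally show ?thesis using pos by simp
qed

lemma half_mass_less_iff: "y \<noteq> 0 \<Longrightarrow> half_mass M y r < half_mass M y s \<longleftrightarrow> r < s"
  using half_mass_strict_mono half_mass_mono by (metis linorder_not_le)

lemma half_mass_le_iff: "y \<noteq> 0 \<Longrightarrow> half_mass M y r \<le> half_mass M y s \<longleftrightarrow> r \<le> s"
  using half_mass_less_iff by (metis linorder_not_le)

lemma continuous_half_mass: "y \<noteq> 0 \<Longrightarrow> isCont (half_mass M y) r"
  unfolding continuous_at_sequentially comp_def using half_mass_tendsto[of "\<lambda>_. y" y] by auto

lemma half_mass_surj:
  assumes "y \<noteq> 0" "0 < q" "q < measure M UNIV"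
  obtains r where "half_mass M y r = q"
proof -
  have "\<forall>\<^sub>F r in at_bot. half_mass M y r < q" using half_mass_at_bot order_tendstoD assms by blast
  then obtain a where a: "half_mass M y a < q" using eventually_happens by force
  have "\<forall>\<^sub>F r in at_top. half_mass M y r > q" using half_mass_at_top order_tendstoD assms by blast
  then obtain b where b: "half_mass M y b > q" using eventually_happens by force
  have "a \<le> b" using a b half_mass_less_iff[OF assms(1), of a b] by simp
  then obtain r where "half_mass M y r = q"
    using IVT[of "half_mass M y" a q b] a b continuous_half_mass[OF assms(1)] by force
  then show thesis using that by blast
qed

end

section \<open>Slabs of half the mass\<close>

text \<open>Extended bounds treat slabs and half-spaces alike and always admit convergent
  subsequences.\<close>

definition ereal_slab :: "'a::euclidean_space \<Rightarrow> ereal \<Rightarrow> ereal \<Rightarrow> 'a set" where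
  "ereal_slab y s r = {x. s \<le> ereal (y \<bullet> x) \<and> ereal (y \<bullet> x) \<le> r}"

lemma ereal_slab_borel [measurable]: "ereal_slab y s r \<in> sets borel"
  unfolding ereal_slab_def by measurable

context full_measure
begin

text \<open>The slab between the quantiles of order \<open>t\<close> and \<open>t + 1 / 2\<close>,
  described by values of the distribution function rather than by the quantiles. Continuity in
  \<open>y\<close> and \<open>t\<close> thus follows from that of \<open>half_mass\<close>.\<close>

definition quantile_slab :: "'a \<Rightarrow> real \<Rightarrow> 'a set" where
  "quantile_slab y t = {x. t * measure M UNIV \<le> half_mass M y (y \<bullet> x) \<and>
     half_mass M y (y \<bullet> x) \<le> (t + 1 / 2) * measure M UNIV}"

lemma total_pos: "measure M UNIV > 0"
  by (rule full) auto

lemma quantile_slab_eq: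
  assumes y: "y \<noteq> 0" and t: "0 \<le> t" "t < 1 / 2"
  obtains s r :: ereal where "quantile_slab y t = ereal_slab y s r"
    "measure M (quantile_slab y t) = measure M UNIV / 2"
proof -
  let ?T = "measure M UNIV"
  have "0 < (t + 1 / 2) * ?T" using total_pos t by simp
  moreover have "(t + 1 / 2) * ?T < ?T" using total_pos t by simp
  ultimately obtain r where r: "half_mass M y r = (t + 1 / 2) * ?T"
    using half_mass_surj[OF y] by blast
  show thesis
  \<comment> \<open>By full support \<open>half_mass M y\<close> is positive everywhere, so the
    quantile of order 0 is minus infinity.\<close>
  proof (cases "t = 0")
    case True
    have eq: "quantile_slab y t = {x. y \<bullet> x \<le> r}"
      unfolding quantile_slab_def r[symmetric] half_mass_le_iff[OF y] using True half_mass_nonneg by auto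
    moreover have "measure M {x. y \<bullet> x \<le> r} = ?T / 2" using r True by (simp add: half_mass_def)
    ultimately show thesis using that[of "-\<infinity>" "ereal r"] by (simp add: ereal_slab_def)
  next
    case False
    then have "0 < t * ?T" "t * ?T < ?T" using total_pos t by simp_all
    then obtain s where s: "half_mass M y s = t * ?T" using half_mass_surj[OF y] by blast
    have eq: "quantile_slab y t = {x. s \<le> y \<bullet> x \<and> y \<bullet> x \<le> r}"
      unfolding quantile_slab_def r[symmetric] s[symmetric] half_mass_le_iff[OF y] by simp
    have "half_mass M y s < half_mass M y r" unfolding r s using total_pos by simp
    then have "s < r" using half_mass_less_iff[OF y] by simp
    have [measurable]: "{x. s \<le> y \<bullet> x \<and> y \<bullet> x \<le> r} \<in> sets M" unfolding sets_M by measurable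
    have "measure M {x. s \<le> y \<bullet> x \<and> y \<bullet> x \<le> r} = measure M ({x. y \<bullet> x \<le> r} - {x. y \<bullet> x \<le> s})"
      using AE_not_hyperplane[OF y, of s] by (intro finite_measure_eq_AE) auto
    also have "\<dots> = half_mass M y r - half_mass M y s"
      unfolding half_mass_def using \<open>s < r\<close> by (intro finite_measure_Diff) auto
    finally have "measure M (quantile_slab y t) = ?T / 2" unfolding eq r s by (simp add: field_simps)
    then show thesis using that[of "ereal s" "ereal r"] eq by (simp add: ereal_slab_def)
  qed
qed

lemma borel_half_mass: "y \<noteq> 0 \<Longrightarrow> (\<lambda>x. half_mass M y (y \<bullet> x)) \<in> borel_measurable borel"
proof (rule borel_measurable_continuous_onI)
  assume "y \<noteq> 0"
  then have "continuous_on UNIV (half_mass M y)"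
    using continuous_half_mass by (simp add: continuous_at_imp_continuous_on)
  then show "continuous_on UNIV (\<lambda>x. half_mass M y (y \<bullet> x))"
    by (rule continuous_on_compose2) (auto intro!: continuous_intros)
qed

lemma quantile_slab_borel [measurable]: "y \<noteq> 0 \<Longrightarrow> quantile_slab y t \<in> sets borel"
  using borel_half_mass[of y] unfolding quantile_slab_def by measurable

text \<open>By strict monotonicity a level set of the distribution function is empty or a single
  hyperplane, which is null for every absolutely continuous \<open>N\<close>, not only for
  \<open>M\<close>.\<close>

lemma AE_half_mass_neq:
  assumes "ac_measure N" and y: "y \<noteq> 0"
  shows "AE x in N. half_mass M y (y \<bullet> x) \<noteq> q"
proof (cases "\<exists>r. half_mass M y r = q")
  case True
  then obtain r where r: "half_mass M y r = q" by blast
  have "AE x in N. y \<bullet> x \<noteq> r" using ac_measure.AE_not_hyperplane assms by blast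
  then show ?thesis
  proof eventually_elim
    case (elim x)
    then show ?case using half_mass_strict_mono[OF y] r by (metis less_irrefl linorder_neqE_linordered_idom)
  qed
qed auto

text \<open>For almost every point both comparisons that define the slab are strict in the limit and
  therefore eventually stable.\<close>

lemma measure_quantile_slab_tendsto:
  assumes N: "ac_measure N" and y: "Y \<longlonglongrightarrow> y" "y \<noteq> 0" "\<And>n. Y n \<noteq> 0" and t: "t' \<longlonglongrightarrow> t"
  shows "(\<lambda>n. measure N (quantile_slab (Y n) (t' n))) \<longlonglongrightarrow> measure N (quantile_slab y t)"
proof (rule measure_tendsto_of_AE[OF ac_measure.finite_M[OF N]])
  let ?T = "measure M UNIV"
  show "AE x in N. \<forall>\<^sub>F n in sequentially. x \<in> quantile_slab (Y n) (t' n) \<longleftrightarrow> x \<in> quantile_slab y t"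
    using AE_half_mass_neq[OF N y(2), of "t * ?T"] AE_half_mass_neq[OF N y(2), of "(t + 1 / 2) * ?T"]
  proof eventually_elim
    case (elim x)
    have le: "\<forall>\<^sub>F n in sequentially. a n \<le> b n \<longleftrightarrow> a0 \<le> b0"
      if "a \<longlonglongrightarrow> a0" "b \<longlonglongrightarrow> b0" "a0 \<noteq> b0" for a b :: "nat \<Rightarrow> real" and a0 b0
    proof -
      have lim: "(\<lambda>n. a n - b n) \<longlonglongrightarrow> a0 - b0" by (intro tendsto_intros that)
      show ?thesis
      proof (cases "a0 < b0")
        case True
        then have "\<forall>\<^sub>F n in sequentially. a n < b n" using order_tendstoD(2)[OF lim, of 0] by simp
        then show ?thesis by eventually_elim (use True in auto)
      next
        case False
        then have "\<forall>\<^sub>F n in sequentially. b n < a n" using that order_tendstoD(1)[OF lim, of 0] by simp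
        then show ?thesis by eventually_elim (use False that in auto)
      qed
    qed
    have lim: "(\<lambda>n. half_mass M (Y n) (Y n \<bullet> x)) \<longlonglongrightarrow> half_mass M y (y \<bullet> x)"
      by (intro half_mass_tendsto y tendsto_intros)
    have "\<forall>\<^sub>F n in sequentially. t' n * ?T \<le> half_mass M (Y n) (Y n \<bullet> x) \<longleftrightarrow> t * ?T \<le> half_mass M y (y \<bullet> x)"
      by (rule le) (use elim in \<open>auto intro!: tendsto_intros t lim\<close>)
    moreover have "\<forall>\<^sub>F n in sequentially. half_mass M (Y n) (Y n \<bullet> x) \<le> (t' n + 1 / 2) * ?T
        \<longleftrightarrow> half_mass M y (y \<bullet> x) \<le> (t + 1 / 2) * ?T"
      by (rule le) (use elim in \<open>auto intro!: tendsto_intros t lim\<close>)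
    ultimately show ?case
      by eventually_elim (simp add: quantile_slab_def)
  qed
qed (simp_all add: ac_measure.sets_M[OF N] y quantile_slab_borel)

text \<open>Reversing the direction replaces a normalized distribution value q by 1 - q, and so the
  interval [t, t + 1/2] by [1/2 - t, 1 - t].\<close>

lemma quantile_slab_uminus:
  assumes "y \<noteq> 0"
  shows "quantile_slab (- y) t = quantile_slab y (1 / 2 - t)"
  unfolding quantile_slab_def inner_minus_left half_mass_uminus[OF assms] by (auto simp: algebra_simps)

text \<open>The two slabs are the half-spaces on either side of the median hyperplane of
  \<open>M\<close> and overlap only in it.\<close>

lemma measure_quantile_slab_complement:
  assumes N: "ac_measure N" and y: "y \<noteq> 0"
  shows "measure N (quantile_slab y 0) + measure N (quantile_slab y (1 / 2)) = measure N UNIV"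
proof -
  interpret N: ac_measure N by fact
  have [measurable]: "quantile_slab y t \<in> sets N" for t using y by (simp add: N.sets_M quantile_slab_borel)
  have "measure N (quantile_slab y (1 / 2)) = measure N (space N - quantile_slab y 0)"
  proof (rule N.finite_measure_eq_AE)
    show "AE x in N. x \<in> quantile_slab y (1 / 2) \<longleftrightarrow> x \<in> space N - quantile_slab y 0"
      using AE_half_mass_neq[OF N y, of "1 / 2 * measure M UNIV"]
    proof eventually_elim
      case (elim x)
      then show ?case using half_mass_nonneg[of y "y \<bullet> x"] half_mass_le[of y "y \<bullet> x"]
        by (auto simp: quantile_slab_def)
    qed
  qed measurable
  then show ?thesis using N.finite_measure_compl[of "quantile_slab y 0"] by simp
qed

end

theorem exists_quantile_slab:
  fixes \<mu> :: "'d::finite \<Rightarrow> (real^'d) measure" and M :: "(real^'d) measure"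
  assumes "full_measure M" and \<mu>: "\<And>i. ac_measure (\<mu> i)"
  shows "\<exists>y s r. norm y = 1 \<and> (\<forall>N\<in>insert M (range \<mu>). measure N (ereal_slab y s r) = measure N UNIV / 2)"
proof -
  interpret full_measure M by fact
  \<comment> \<open>The affine function of the sup-norm with value 0 at norm 2, where opposite slabs
    are complementary, and 1/4 at norm 1, where they coincide.\<close>
  define t where "t = (\<lambda>y :: real^'d. (2 - infnorm y) / 4)"
  define G :: "real^'d \<Rightarrow> real^'d" where
    "G y = (\<chi> i. measure (\<mu> i) (quantile_slab y (t y)) - measure (\<mu> i) UNIV / 2)" for y
  have nz: "y \<noteq> 0" if "1 \<le> infnorm y" for y :: "real^'d" using that by (auto simp: infnorm_0)
  obtain y where y: "1 \<le> infnorm y" "infnorm y \<le> 2" "G y = 0"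
  proof (rule annulus_zero[of G])
    show "continuous_on {y. 1 \<le> infnorm y \<and> infnorm y \<le> 2} G"
      unfolding continuous_on_sequentially comp_def
    proof clarify
      fix Y and y :: "real^'d"
      assume Y: "\<forall>n. Y n \<in> {y. 1 \<le> infnorm y \<and> infnorm y \<le> 2}" "Y \<longlonglongrightarrow> y" and y: "1 \<le> infnorm y" "infnorm y \<le> 2"
      have "(\<lambda>n. t (Y n)) \<longlonglongrightarrow> t y" unfolding t_def by (intro tendsto_intros Y) simp
      then have "(\<lambda>n. measure (\<mu> i) (quantile_slab (Y n) (t (Y n)))) \<longlonglongrightarrow> measure (\<mu> i) (quantile_slab y (t y))" for i
        using Y y nz by (intro measure_quantile_slab_tendsto \<mu>) auto
      then show "(\<lambda>n. G (Y n)) \<longlonglongrightarrow> G y"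
        unfolding G_def by (intro tendsto_vec_lambda tendsto_intros)
    qed
  next
    fix y :: "real^'d" assume y: "infnorm y = 2"
    then have "t y = 0" "t (- y) = 0" "y \<noteq> 0" using nz[of y] by (auto simp: t_def infnorm_neg)
    then have "measure (\<mu> i) (quantile_slab y (t y)) + measure (\<mu> i) (quantile_slab (- y) (t (- y))) = measure (\<mu> i) UNIV" for i
      using measure_quantile_slab_complement[OF \<mu>, of y] quantile_slab_uminus[of y 0] by simp
    then show "G (- y) = - G y"
      by (simp add: G_def vec_eq_iff) (smt (verit, ccfv_SIG) field_sum_of_halves)
  next
    fix y :: "real^'d" assume y: "infnorm y = 1"
    then have t: "t y = 1 / 4" "t (- y) = 1 / 4" and "y \<noteq> 0" using nz[of y] by (auto simp: t_def infnorm_neg)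
    then have "quantile_slab (- y) (1 / 4) = quantile_slab y (1 / 4)" using quantile_slab_uminus[of y "1 / 4"] by simp
    then show "G (- y) = G y" unfolding G_def t by simp
  qed
  have y0: "y \<noteq> 0" using nz y by simp
  obtain s r where sr: "quantile_slab y (t y) = ereal_slab y s r"
    "measure M (quantile_slab y (t y)) = measure M UNIV / 2"
    using quantile_slab_eq[OF y0, of "t y"] y by (auto simp: t_def)
  have half: "measure N (quantile_slab y (t y)) = measure N UNIV / 2" if "N \<in> insert M (range \<mu>)" for N
    using that y(3) sr(2) by (auto simp: G_def vec_eq_iff)
  \<comment> \<open>Rescaling to a unit normal keeps the slab and makes the directions range over a
    compact set for the later limit.\<close>
  define c where "c = ereal (1 / norm y)"
  have c: "0 < c" "c \<noteq> \<infinity>" "\<not> c < 0" using y0 by (auto simp: c_def)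
  have "ereal ((y /\<^sub>R norm y) \<bullet> x) = c * ereal (y \<bullet> x)" for x by (simp add: c_def divide_inverse)
  then have "c * s \<le> ereal ((y /\<^sub>R norm y) \<bullet> x) \<longleftrightarrow> s \<le> ereal (y \<bullet> x)"
     "ereal ((y /\<^sub>R norm y) \<bullet> x) \<le> c * r \<longleftrightarrow> ereal (y \<bullet> x) \<le> r" for x
    using c by (simp_all add: ereal_mult_le_mult_iff)
  then have "ereal_slab (y /\<^sub>R norm y) (c * s) (c * r) = quantile_slab y (t y)"
    unfolding sr(1) ereal_slab_def by simp
  moreover have "norm (y /\<^sub>R norm y) = 1" using y0 by simp
  ultimately show ?thesis using half by metis
qed

section \<open>Removing the full support\<close>

text \<open>Sigma-finiteness of Lebesgue measure yields an everywhere positive function with finite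
  integral. With this density, null sets are Lebesgue null, and no nonempty open set is.\<close>

lemma exists_full_ac_measure: "\<exists>N :: 'a::euclidean_space measure. full_measure N"
proof -
  obtain h where h: "h \<in> borel_measurable (lborel :: 'a measure)" "integral\<^sup>N lborel h \<noteq> \<infinity>"
    "\<And>x. 0 < h x \<and> h x < \<infinity>"
    using sigma_finite_measure.Ex_finite_integrable_function[OF sigma_finite_lborel] by (auto simp: space_lborel)
  define N where "N = density lborel h"
  have sets_N: "sets N = sets borel" by (simp add: N_def)
  have fin: "finite_measure N"
    by (rule finite_measureI) (use h in \<open>simp add: N_def emeasure_density cong: nn_integral_cong\<close>)
  have ac: "absolutely_continuous lborel N"
    unfolding N_def by (rule absolutely_continuousI_density) (use h in simp)
  have "measure N U > 0" if U: "open U" "U \<noteq> {}" for U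
  proof (rule ccontr)
    interpret finite_measure N by fact
    assume "\<not> ?thesis"
    then have "emeasure N U = 0" by (simp add: emeasure_eq_measure zero_less_measure_iff)
    then have "U \<in> null_sets (density lborel h)" using U sets_N by (simp add: N_def null_sets_def)
    then have "AE x in lborel. x \<in> U \<longrightarrow> h x = 0" using h by (simp add: null_sets_density_iff)
    then have "AE x in lborel. x \<notin> U" by eventually_elim (metis h(3) less_irrefl)
    then have "U \<in> null_sets lborel" using U by (subst (asm) AE_iff_null_sets[symmetric]) auto
    then have "negligible U" by (simp add: negligible_iff_null_sets null_sets_completionI)
    then show False using open_not_negligible U by blast
  qed
  then show ?thesis
    using fin sets_N ac by (intro exI[of _ N]) (simp add: full_measure_def full_measure_axioms_def ac_measure_def)
qed

text \<open>The sum of the measures is built from Radon-Nikodym densities, so that absolute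
  continuity comes with the construction.\<close>

lemma perturbed_full_measure:
  fixes M N :: "'a::euclidean_space measure"
  assumes M: "ac_measure M" and N: "full_measure N" and e: "e > 0"
  shows "\<exists>P. full_measure P \<and> (\<forall>A\<in>sets borel. measure P A = measure M A + e * measure N A)"
proof -
  interpret M: ac_measure M by fact
  interpret N: full_measure N by fact
  obtain f where f: "f \<in> borel_measurable lborel" "density lborel f = M"
    using sigma_finite_measure.Radon_Nikodym[OF sigma_finite_lborel, of M] M.ac M.sets_M by auto
  obtain g where g: "g \<in> borel_measurable lborel" "density lborel g = N"
    using sigma_finite_measure.Radon_Nikodym[OF sigma_finite_lborel, of N] N.ac N.sets_M by auto
  define P where "P = density lborel (\<lambda>x. f x + ennreal e * g x)"
  have sets_P: "sets P = sets borel" by (simp add: P_def)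
  have em: "emeasure P A = emeasure M A + ennreal e * emeasure N A" if A: "A \<in> sets borel" for A
  proof -
    have [measurable]: "A \<in> sets lborel" "f \<in> borel_measurable lborel" "g \<in> borel_measurable lborel"
      using A f g by auto
    have "emeasure P A = (\<integral>\<^sup>+x. (f x + ennreal e * g x) * indicator A x \<partial>lborel)"
      unfolding P_def by (rule emeasure_density) measurable
    also have "\<dots> = (\<integral>\<^sup>+x. f x * indicator A x + ennreal e * (g x * indicator A x) \<partial>lborel)"
      by (simp add: distrib_right mult.assoc)
    also have "\<dots> = (\<integral>\<^sup>+x. f x * indicator A x \<partial>lborel) + ennreal e * (\<integral>\<^sup>+x. g x * indicator A x \<partial>lborel)"
      by (subst nn_integral_add) (auto simp: nn_integral_cmult)
    also have "\<dots> = emeasure (density lborel f) A + ennreal e * emeasure (density lborel g) A"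
      using A f(1) g(1) by (simp add: emeasure_density)
    finally show ?thesis using f g by simp
  qed
  have m: "emeasure P A = ennreal (measure M A + e * measure N A)" if "A \<in> sets borel" for A
    using e unfolding em[OF that] M.emeasure_eq_measure N.emeasure_eq_measure
    by (simp add: ennreal_mult ennreal_plus)
  have meas: "measure P A = measure M A + e * measure N A" if "A \<in> sets borel" for A
    by (rule measure_eq_emeasure_eq_ennreal[OF _ m[OF that]]) (use e in simp)
  have fin: "finite_measure P"
  proof (rule finite_measureI)
    have "space P = UNIV" by (simp add: P_def)
    then show "emeasure P (space P) \<noteq> \<infinity>" using m[of UNIV] by simp
  qed
  have ac: "absolutely_continuous lborel P"
    unfolding P_def by (rule absolutely_continuousI_density) (use f g in auto)
  have "measure P U > 0" if U: "open U" "U \<noteq> {}" for U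
    using meas[of U] N.full[OF U] U e by (simp add: add_nonneg_pos)
  then have "full_measure P"
    using fin sets_P ac by (simp add: full_measure_def full_measure_axioms_def ac_measure_def)
  then show ?thesis using meas by blast
qed

lemma eventually_le_iff_limits:
  fixes a b :: "nat \<Rightarrow> 'a::{dense_linorder,linorder_topology}"
  assumes "a \<longlonglongrightarrow> a0" "b \<longlonglongrightarrow> b0" "a0 \<noteq> b0"
  shows "\<forall>\<^sub>F n in sequentially. a n \<le> b n \<longleftrightarrow> a0 \<le> b0"
proof (cases "a0 < b0")
  case True
  then obtain c where "a0 < c" "c < b0" using dense by blast
  then have "\<forall>\<^sub>F n in sequentially. a n < c" "\<forall>\<^sub>F n in sequentially. c < b n"
    using assms order_tendstoD by blast+
  then show ?thesis by eventually_elim (use True in auto)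
next
  case False
  then have "b0 < a0" using assms(3) not_less_iff_gr_or_eq by blast
  then obtain c where "b0 < c" "c < a0" using dense by blast
  then have "\<forall>\<^sub>F n in sequentially. c < a n" "\<forall>\<^sub>F n in sequentially. b n < c"
    using assms order_tendstoD by blast+
  then show ?thesis by eventually_elim (use \<open>b0 < a0\<close> in auto)
qed

lemma measure_ereal_slab_tendsto:
  assumes N: "ac_measure N" and y: "Y \<longlonglongrightarrow> y" "y \<noteq> 0" and S: "S \<longlonglongrightarrow> s" and R: "R \<longlonglongrightarrow> r"
  shows "(\<lambda>n. measure N (ereal_slab (Y n) (S n) (R n))) \<longlonglongrightarrow> measure N (ereal_slab y s r)"
proof (rule measure_tendsto_of_AE[OF ac_measure.finite_M[OF N]])
  \<comment> \<open>For infinite \<open>q\<close> the claim is trivial, since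
    \<open>y \<bullet> x\<close> is real; the conversion matters only for finite
    \<open>q\<close>.\<close>
  have neq: "AE x in N. ereal (y \<bullet> x) \<noteq> q" for q
    using ac_measure.AE_not_hyperplane[OF N y(2), of "real_of_ereal q"]
    by eventually_elim auto
  show "AE x in N. \<forall>\<^sub>F n in sequentially. x \<in> ereal_slab (Y n) (S n) (R n) \<longleftrightarrow> x \<in> ereal_slab y s r"
    using neq[of s] neq[of r]
  proof eventually_elim
    case (elim x)
    have lim: "(\<lambda>n. ereal (Y n \<bullet> x)) \<longlonglongrightarrow> ereal (y \<bullet> x)" by (intro tendsto_intros y)
    have "\<forall>\<^sub>F n in sequentially. S n \<le> ereal (Y n \<bullet> x) \<longleftrightarrow> s \<le> ereal (y \<bullet> x)"
      by (rule eventually_le_iff_limits[OF S lim]) (use elim in simp)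
    moreover have "\<forall>\<^sub>F n in sequentially. ereal (Y n \<bullet> x) \<le> R n \<longleftrightarrow> ereal (y \<bullet> x) \<le> r"
      by (rule eventually_le_iff_limits[OF lim R]) (use elim in simp)
    ultimately show ?case by eventually_elim (simp add: ereal_slab_def)
  qed
qed (simp_all add: ac_measure.sets_M[OF N])

text \<open>Both the unit sphere and the extended real line are compact; bounds that escape to
  infinity thus still have a limit.\<close>

lemma ereal_slab_convergent_subseq:
  fixes Y :: "nat \<Rightarrow> 'a::euclidean_space" and S R :: "nat \<Rightarrow> ereal"
  assumes "\<And>n. norm (Y n) = 1"
  obtains y s r and k :: "nat \<Rightarrow> nat" where "strict_mono k" "(Y \<circ> k) \<longlonglongrightarrow> y" "norm y = 1" "(S \<circ> k) \<longlonglongrightarrow> s" "(R \<circ> k) \<longlonglongrightarrow> r"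
proof -
  have "seq_compact (sphere (0 :: 'a) 1)" by (simp add: compact_imp_seq_compact)
  moreover have "\<forall>n. Y n \<in> sphere 0 1" using assms by simp
  ultimately obtain y k1 where k1: "y \<in> sphere 0 1" "strict_mono k1" "(Y \<circ> k1) \<longlonglongrightarrow> y"
    by (rule seq_compactE)
  obtain s k2 where k2: "strict_mono k2" "((S \<circ> k1) \<circ> k2) \<longlonglongrightarrow> s"
    using compact_complete_linorder by blast
  obtain r k3 where k3: "strict_mono k3" "((R \<circ> (k1 \<circ> k2)) \<circ> k3) \<longlonglongrightarrow> r"
    using compact_complete_linorder by blast
  show thesis
  proof (rule that[of "k1 \<circ> k2 \<circ> k3"])
    show "strict_mono (k1 \<circ> k2 \<circ> k3)" using k1 k2 k3 by (simp add: strict_mono_o)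
    show "(Y \<circ> (k1 \<circ> k2 \<circ> k3)) \<longlonglongrightarrow> y"
      using LIMSEQ_subseq_LIMSEQ[OF k1(3), of "k2 \<circ> k3"] k2 k3 by (simp add: strict_mono_o o_assoc)
    show "(S \<circ> (k1 \<circ> k2 \<circ> k3)) \<longlonglongrightarrow> s"
      using LIMSEQ_subseq_LIMSEQ[OF k2(2) k3(1)] by (simp add: o_assoc)
    show "(R \<circ> (k1 \<circ> k2 \<circ> k3)) \<longlonglongrightarrow> r" using k3 by (simp add: o_assoc)
  qed (use k1 in simp)
qed

text \<open>The slabs of the last two kinds carry all or none of an absolutely continuous measure,
  so a slab that halves a nonzero one is of the desired form.\<close>

lemma ereal_slab_cases:
  fixes y :: "'a::euclidean_space"
  assumes y: "y \<noteq> 0"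
  shows "(\<exists>H1. (\<exists>H2. closed_region_between H1 H2 (ereal_slab y s r)) \<or> closed_halfspace_bounded_by H1 (ereal_slab y s r))
    \<or> ereal_slab y s r = UNIV \<or> (\<exists>a. ereal_slab y s r \<subseteq> {x. y \<bullet> x = a})"
proof (cases s; cases r)
  fix a b assume sr: "s = ereal a" "r = ereal b"
  have eq: "ereal_slab y s r = {x. a \<le> y \<bullet> x \<and> y \<bullet> x \<le> b}" by (simp add: ereal_slab_def sr)
  show ?thesis
  proof (cases "a < b")
    case True
    then show ?thesis unfolding eq closed_region_between_def using y by blast
  next
    case False
    then have "ereal_slab y s r \<subseteq> {x. y \<bullet> x = a}" unfolding eq by auto
    then show ?thesis by blast
  qed
next
  fix a assume sr: "s = ereal a" "r = \<infinity>"
  have eq: "ereal_slab y s r = {x. a \<le> y \<bullet> x}" by (simp add: ereal_slab_def sr)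
  show ?thesis unfolding eq closed_halfspace_bounded_by_def using y by blast
next
  fix b assume sr: "s = -\<infinity>" "r = ereal b"
  \<comment> \<open>\<open>closed_halfspace_bounded_by\<close> describes half-spaces with a lower
    bound, so the normal is reversed.\<close>
  have eq: "ereal_slab y s r = {x. - b \<le> (- y) \<bullet> x}" by (simp add: ereal_slab_def sr)
  have "- y \<noteq> 0" using y by simp
  then show ?thesis unfolding eq closed_halfspace_bounded_by_def by blast
qed (auto simp: ereal_slab_def)


text \<open>The slab at stage \<open>n\<close> halves every \<open>\<mu> i\<close> exactly, together
  with the sum of \<open>M\<close> and \<open>N / (n + 1)\<close>. Along a convergent subsequence
  the contribution of \<open>N\<close> vanishes and all masses pass to the limit slab.\<close>

lemma exists_ereal_slab:
  fixes \<mu> :: "'d::finite \<Rightarrow> (real^'d) measure" and M :: "(real^'d) measure"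
  assumes M: "ac_measure M" and \<mu>: "\<And>i. ac_measure (\<mu> i)"
  shows "\<exists>y s r. norm y = 1 \<and> (\<forall>N\<in>insert M (range \<mu>). measure N (ereal_slab y s r) = measure N UNIV / 2)"
proof -
  obtain N :: "(real^'d) measure" where N: "full_measure N" using exists_full_ac_measure by blast
  define Q where "Q = (\<lambda>n y s r. norm y = 1 \<and> (\<forall>i. measure (\<mu> i) (ereal_slab y s r) = measure (\<mu> i) UNIV / 2) \<and>
     measure M (ereal_slab y s r) + inverse (real (Suc n)) * measure N (ereal_slab y s r) =
     (measure M UNIV + inverse (real (Suc n)) * measure N UNIV) / 2)"
  have "\<exists>y s r. Q n y s r" for n
  proof -
    have "inverse (real (Suc n)) > 0" by simp
    from perturbed_full_measure[OF M N this] obtain P where P: "full_measure P"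
      and P_eq: "\<forall>A\<in>sets borel. measure P A = measure M A + inverse (real (Suc n)) * measure N A"
      by (elim exE conjE)
    from exists_quantile_slab[of P \<mu>, OF P \<mu>] obtain y s r where y: "norm y = 1"
      and half: "\<forall>N\<in>insert P (range \<mu>). measure N (ereal_slab y s r) = measure N UNIV / 2"
      by (elim exE conjE)
    have "measure P (ereal_slab y s r) = measure P UNIV / 2" by (rule bspec[OF half]) simp
    moreover have "measure P (ereal_slab y s r) = measure M (ereal_slab y s r) + inverse (real (Suc n)) * measure N (ereal_slab y s r)"
      using P_eq ereal_slab_borel by (rule bspec)
    moreover have "measure P UNIV = measure M UNIV + inverse (real (Suc n)) * measure N UNIV"
      by (rule bspec[OF P_eq]) simp
    ultimately have "measure M (ereal_slab y s r) + inverse (real (Suc n)) * measure N (ereal_slab y s r) =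
       (measure M UNIV + inverse (real (Suc n)) * measure N UNIV) / 2"
      by (simp only:)
    moreover have "\<forall>i. measure (\<mu> i) (ereal_slab y s r) = measure (\<mu> i) UNIV / 2"
      by (intro allI bspec[OF half]) simp
    ultimately show ?thesis using y unfolding Q_def by blast
  qed
  then obtain Y S R where Q: "\<And>n. Q n (Y n) (S n) (R n)" by metis
  note Y = Q[unfolded Q_def, THEN conjunct1]
    and \<mu>_half = Q[unfolded Q_def, THEN conjunct2, THEN conjunct1, THEN spec]
    and M_half = Q[unfolded Q_def, THEN conjunct2, THEN conjunct2]
  obtain y s r k where k: "strict_mono k" "(Y \<circ> k) \<longlonglongrightarrow> y" "norm y = 1" "(S \<circ> k) \<longlonglongrightarrow> s" "(R \<circ> k) \<longlonglongrightarrow> r"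
    using ereal_slab_convergent_subseq[of Y S R, OF Y] by metis
  then have "y \<noteq> 0" by auto
  have lim: "(\<lambda>n. measure L (ereal_slab (Y (k n)) (S (k n)) (R (k n)))) \<longlonglongrightarrow> measure L (ereal_slab y s r)"
    if "ac_measure L" for L
    using measure_ereal_slab_tendsto[OF that k(2) \<open>y \<noteq> 0\<close> k(4,5)] by simp
  show ?thesis
  proof (intro exI conjI ballI)
    show "norm y = 1" by (rule k(3))
    fix L assume "L \<in> insert M (range \<mu>)"
    then consider (M) "L = M" | (mu) i where "L = \<mu> i" by blast
    then show "measure L (ereal_slab y s r) = measure L UNIV / 2"
    proof cases
      case M
      have inv: "(\<lambda>n. inverse (real (Suc (k n)))) \<longlonglongrightarrow> 0"
        using LIMSEQ_subseq_LIMSEQ[OF LIMSEQ_inverse_real_of_nat k(1)] by (simp add: comp_def)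
      have "ac_measure N" using N by (simp add: full_measure_def)
      then have "(\<lambda>n. (measure M UNIV + inverse (real (Suc (k n))) * measure N UNIV) / 2)
          \<longlonglongrightarrow> measure M (ereal_slab y s r) + 0 * measure N (ereal_slab y s r)"
        unfolding M_half[symmetric] by (intro tendsto_intros inv lim assms)
      moreover have "(\<lambda>n. (measure M UNIV + inverse (real (Suc (k n))) * measure N UNIV) / 2)
          \<longlonglongrightarrow> (measure M UNIV + 0 * measure N UNIV) / 2"
        by (intro tendsto_intros inv) simp
      ultimately have "measure M (ereal_slab y s r) + 0 * measure N (ereal_slab y s r) = (measure M UNIV + 0 * measure N UNIV) / 2"
        by (rule LIMSEQ_unique)
      then show ?thesis using M by simp
    next
      case mu
      have "(\<lambda>n. measure (\<mu> i) UNIV / 2) \<longlonglongrightarrow> measure (\<mu> i) (ereal_slab y s r)"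
        using lim[OF \<mu>[of i]] unfolding \<mu>_half .
      then show ?thesis using mu by (simp add: LIMSEQ_const_iff)
    qed
  qed
qed

section \<open>Indexing of the measures and exclusion of degenerate slabs\<close>

theorem theorem1p2:
  fixes \<mu> :: "nat \<Rightarrow> (real ^ 'd) measure"
  assumes "\<And>i. i \<in> {1..CARD('d) + 1} \<Longrightarrow> finite_measure (\<mu> i)"
    and "\<And>i. i \<in> {1..CARD('d) + 1} \<Longrightarrow> sets (\<mu> i) = sets borel"
    and "\<And>i. i \<in> {1..CARD('d) + 1} \<Longrightarrow> absolutely_continuous lborel (\<mu> i)"
  shows "\<exists>H1 A. ((\<exists>H2. closed_region_between H1 H2 A) \<or> closed_halfspace_bounded_by H1 A) \<and>
           (\<forall>i\<in>{1..CARD('d) + 1}. measure (\<mu> i) A = 1 / 2 * measure (\<mu> i) UNIV)"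
proof -
  let ?I = "{1..CARD('d) + 1}"
  have ac: "ac_measure (\<mu> i)" if "i \<in> ?I" for i
    using assms that by (simp add: ac_measure_def)
  obtain f :: "nat \<Rightarrow> 'd" where f: "bij_betw f {1..CARD('d)} UNIV"
    using ex_bij_betw_nat_finite_1[of "UNIV :: 'd set"] by auto
  \<comment> \<open>The first \<open>CARD('d)\<close> measures are indexed by the coordinates of the
    target space; the last one takes the part of nu.\<close>
  define g where "g = inv_into {1..CARD('d)} f"
  have g: "bij_betw g UNIV {1..CARD('d)}" unfolding g_def by (rule bij_betw_inv_into[OF f])
  have g_in: "g j \<in> {1..CARD('d)}" for j using g by (auto simp: bij_betw_def)
  have "\<exists>y s r. norm y = 1 \<and> (\<forall>N\<in>insert (\<mu> (CARD('d) + 1)) (range (\<lambda>j. \<mu> (g j))).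
      measure N (ereal_slab y s r) = measure N UNIV / 2)"
  proof (rule exists_ereal_slab)
    show "ac_measure (\<mu> (CARD('d) + 1))" by (rule ac) simp
    show "ac_measure (\<mu> (g j))" for j using g_in[of j] by (intro ac) auto
  qed
  then obtain y s r where ysr: "norm y = 1"
    "\<forall>N\<in>insert (\<mu> (CARD('d) + 1)) (range (\<lambda>j. \<mu> (g j))). measure N (ereal_slab y s r) = measure N UNIV / 2"
    by (elim exE conjE)
  have half: "measure (\<mu> i) (ereal_slab y s r) = measure (\<mu> i) UNIV / 2" if i: "i \<in> ?I" for i
  proof (cases "i = CARD('d) + 1")
    case False
    then have "i \<in> range g" using i g by (auto simp: bij_betw_def)
    then show ?thesis using ysr(2) by blast
  qed (use ysr(2) in simp)
  have "y \<noteq> 0" using ysr(1) by auto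
  show ?thesis
  proof (cases "\<forall>i\<in>?I. measure (\<mu> i) UNIV = 0")
    \<comment> \<open>If all measures vanish, the slab found may be degenerate, but then any genuine
      slab will do.\<close>
    case True
    define A where "A = {x. 0 \<le> y \<bullet> x \<and> y \<bullet> x \<le> 1}"
    have "closed_region_between {x. y \<bullet> x = 0} {x. y \<bullet> x = 1} A"
      unfolding closed_region_between_def A_def using \<open>y \<noteq> 0\<close> zero_less_one by blast
    moreover have "measure (\<mu> i) A = 1 / 2 * measure (\<mu> i) UNIV" if "i \<in> ?I" for i
    proof -
      interpret ac_measure "\<mu> i" using ac that .
      have "measure (\<mu> i) A = 0"
        using bounded_measure[of A] True that by (simp add: measure_le_0_iff)
      then show ?thesis using True that by simp
    qed
    ultimately show ?thesis by blast
  next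
    case False
    then obtain i where i: "i \<in> ?I" "measure (\<mu> i) UNIV \<noteq> 0" by blast
    interpret ac_measure "\<mu> i" using ac i(1) .
    have "ereal_slab y s r \<noteq> UNIV" using half[OF i(1)] i(2) by auto
    moreover have "\<not> ereal_slab y s r \<subseteq> {x. y \<bullet> x = a}" for a
    proof
      assume "ereal_slab y s r \<subseteq> {x. y \<bullet> x = a}"
      then have "ereal_slab y s r \<in> null_sets (\<mu> i)"
        using hyperplane_null[OF \<open>y \<noteq> 0\<close>, of a] by (rule null_sets_subset[rotated 2]) (simp add: sets_M)
      then show False using half[OF i(1)] i(2) by (simp add: measure_eq_0_null_sets)
    qed
    ultimately obtain H1 where "(\<exists>H2. closed_region_between H1 H2 (ereal_slab y s r)) \<or>
        closed_halfspace_bounded_by H1 (ereal_slab y s r)"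
      using ereal_slab_cases[OF \<open>y \<noteq> 0\<close>, of s r] by blast
    moreover have "\<forall>i\<in>?I. measure (\<mu> i) (ereal_slab y s r) = 1 / 2 * measure (\<mu> i) UNIV"
      using half by simp
    ultimately show ?thesis by blast
  qed
qed

end
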